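(* Let $2\le k\le n-1$ and let $\gamma_k\in(0,1)$ be as specified in the context. There exist constants $\delta_1\in(0,1)$ and $C_{12}>0$, depending only on $k,n,\gamma_k$ (and in particular not on $\mu$), such that for every $\mu>0$, every $0<\delta\le\delta_1$ and all $R^{(0)},R^{(1)}\in D_{\delta,\mu,\gamma_k}$, $$F_k\left(R^{(1)}\right)-F_k\left(R^{(0)}\right)\le\sum_{i,j=1}^n\frac{\partial F_k\left(R^{(0)}\right)}{\partial R_{ij}}\left(R^{(1)}_{ij}-R^{(0)}_{ij}\right)+d,\qquad\text{where } d=4nC_{12}\delta^2 .$$ That is, $F_k$ is $d$-concave on $D_{\delta,\mu,\gamma_k}$.
   Context: For $R\in\mathbb{R}^{n\times n}$, $S_k(R)=\sigma_k(\lambda(R))$, where $\lambda(R)\in\mathbb{C}^n$ is the vector of eigenvalues of $R$ and $\sigma_k(\lambda)=\sum_{1\le i_1<\cdots<i_k\le n}\lambda_{i_1}\cdots\lambda_{i_k}$; equivalently $S_k(R)$ is the sum of all $k\times k$ principal minors of $R$. $F_k(R)=\log S_k(R)$; it is regarded as a function of the $n^2$ independent entries $R_{ij}$. $\|\cdot\|$ is the operator norm and $\lambda_{\min}(\omega)$ the least eigenvalue of a symmetric matrix $\omega$. For $0\le\delta<1$, $\mu\ge0$: $D_{\delta,\mu}$ is the set of $R=\omega+\beta\in\mathbb{R}^{n\times n}$ with $\omega^T=\omega>0$, $\beta^T=-\beta$, $\|\beta\|\le\mu$ and $\mu\le\delta\lambda_{\min}(\omega)$. On $D_{\delta,\mu}$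 one has $S_k(R)>0$. $\Gamma_n=\{\lambda\in\mathbb{R}^n:\lambda_j>0,\ j=1,\dots,n\}$. $\Sigma_{(\gamma_k)}$ is the set of $\lambda\in\Gamma_n$ with $\min_j\lambda_j\ge\gamma_k\max_j\lambda_j$, where: (i) if $k\in\{2,3,4,n-2,n-1\}$, $\gamma_k$ is some fixed number in $(0,1)$; (ii) if $[\frac n2]+1\le k\le n-3$, $\gamma_k=\frac{n-k}{k}$; (iii) if $5\le k\le[\frac n2]$, $\gamma_k=\frac{k-2}{n-(k-2)}$. For $0<\delta<1$, $\mu>0$: $D_{\delta,\mu,\gamma_k}=\{R=\omega+\beta\in D_{\delta,\mu}:\lambda(\omega)\in\Sigma_{(\gamma_k)}\}$, where $\lambda(\omega)$ is the vector of eigenvalues of $\omega$. *)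

theory Defs
  imports "HOL-Analysis.Analysis" "HOL-Computational_Algebra.Fundamental_Theorem_Algebra"
begin

definition charpoly :: "'a::comm_ring_1 ^ 'n ^ 'n \<Rightarrow> 'a poly" where
  "charpoly A = det (\<chi> i j. (if i = j then [:0, 1:] else 0) - [:A $ i $ j:])"

definition is_eigenvalue_vector :: "real ^ 'n ^ 'n \<Rightarrow> complex ^ 'n \<Rightarrow> bool" where
  "is_eigenvalue_vector R l \<longleftrightarrow>
     map_poly complex_of_real (charpoly R) = (\<Prod>i\<in>UNIV. [:- (l $ i), 1:])"

text \<open>The eigenvalues with algebraic multiplicity, in an arbitrary order. Everything below is
  invariant under permutation of the components, so the choice does not matter.\<close>

definition eigenvalues :: "real ^ 'n ^ 'n \<Rightarrow> complex ^ 'n" where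
  "eigenvalues R = (SOME l. is_eigenvalue_vector R l)"

text \<open>Only for symmetric matrices, all of whose eigenvalues are real, so that taking real
  parts merely changes the type.\<close>

definition real_eigenvalues :: "real ^ 'n ^ 'n \<Rightarrow> real ^ 'n" where
  "real_eigenvalues w = (\<chi> i. Re (eigenvalues w $ i))"

definition lambda_min :: "real ^ 'n ^ 'n \<Rightarrow> real" where
  "lambda_min w = Min (range (($) (real_eigenvalues w)))"

definition sigma :: "nat \<Rightarrow> 'a::comm_semiring_1 ^ 'n \<Rightarrow> 'a" where
  "sigma k l = (\<Sum>I\<in>{I. card I = k}. \<Prod>i\<in>I. l $ i)"

text \<open>The value of \<^term>\<open>sigma k (eigenvalues R)\<close> is real, because up to sign it is a
  coefficient of the characteristic polynomial of the real matrix \<^term>\<open>R\<close>.\<close>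

definition S_k :: "nat \<Rightarrow> real ^ 'n ^ 'n \<Rightarrow> real" where
  "S_k k R = Re (sigma k (eigenvalues R))"

definition F_k :: "nat \<Rightarrow> real ^ 'n ^ 'n \<Rightarrow> real" where
  "F_k k R = ln (S_k k R)"

definition entry_deriv ::
  "(real ^ 'n ^ 'n \<Rightarrow> real) \<Rightarrow> 'n \<Rightarrow> 'n \<Rightarrow> real ^ 'n ^ 'n \<Rightarrow> real" where
  "entry_deriv f i j R =
     deriv (\<lambda>t. f (\<chi> p q. if p = i \<and> q = j then t else R $ p $ q)) (R $ i $ j)"

definition pos_def :: "real ^ 'n ^ 'n \<Rightarrow> bool" where
  "pos_def w \<longleftrightarrow> (\<forall>v. v \<noteq> 0 \<longrightarrow> v \<bullet> (w *v v) > 0)"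

definition D_dom :: "real \<Rightarrow> real \<Rightarrow> (real ^ 'n ^ 'n) set" where
  "D_dom \<delta> \<mu> = {w + b | w b.
     transpose w = w \<and> pos_def w \<and> transpose b = - b \<and>
     onorm ((*v) b) \<le> \<mu> \<and> \<mu> \<le> \<delta> * lambda_min w}"

definition positive_cone :: "(real ^ 'n) set" where
  "positive_cone = {l. \<forall>j. l $ j > 0}"

definition Sigma_cone :: "real \<Rightarrow> (real ^ 'n) set" where
  "Sigma_cone \<gamma> = {l \<in> positive_cone. Min (range (($) l)) \<ge> \<gamma> * Max (range (($) l))}"

text \<open>The splitting of a matrix into a symmetric and a skew-symmetric part is unique, so the
  \<^term>\<open>w\<close> below is the one from \<^term>\<open>D_dom\<close>.\<close>

definition D_gamma :: "real \<Rightarrow> real \<Rightarrow> real \<Rightarrow> (real ^ 'n ^ 'n) set" where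
  "D_gamma \<delta> \<mu> \<gamma> = {w + b | w b.
     w + b \<in> D_dom \<delta> \<mu> \<and> transpose w = w \<and> transpose b = - b \<and>
     real_eigenvalues w \<in> Sigma_cone \<gamma>}"

text \<open>The three ranges of \<^term>\<open>k\<close> overlap only for \<^term>\<open>n = 7\<close>, \<^term>\<open>k = 4\<close>, where the first
  case leaves the value free and the second one would prescribe 3/4; the disjunction
  allows every value in (0,1).\<close>

definition admissible_gamma :: "nat \<Rightarrow> nat \<Rightarrow> real \<Rightarrow> bool" where
  "admissible_gamma n k \<gamma> \<longleftrightarrow> 0 < \<gamma> \<and> \<gamma> < 1 \<and>
     (k \<in> {2, 3, 4, n - 2, n - 1} \<or>
      (n div 2 + 1 \<le> k \<and> k \<le> n - 3 \<and> \<gamma> = (real n - real k) / real k) \<or>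
      (5 \<le> k \<and> k \<le> n div 2 \<and> \<gamma> = (real k - 2) / (real n - (real k - 2))))"

lemma degree_charpoly_monic:
  fixes A :: "'a::idom ^ 'n ^ 'n"
  shows "degree (charpoly A) = CARD('n) \<and> lead_coeff (charpoly A) = 1"
proof -
  define B :: "'a poly ^ 'n ^ 'n" where
    "B = (\<chi> i j. (if i = j then [:0, 1:] else 0) - [:A $ i $ j:])"
  define t where "t p = of_int (sign p) * (\<Prod>i\<in>UNIV. B $ i $ p i)" for p
  have Bd: "B $ i $ i = [:- (A $ i $ i), 1:]" for i by (simp add: B_def)
  have dB: "degree (B $ i $ j) \<le> (if i = j then 1 else 0)" for i j
    by (simp add: B_def)
  have tid: "degree (t id) = CARD('n) \<and> lead_coeff (t id) = 1"
  proof -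
    have "t id = (\<Prod>i\<in>UNIV. [:- (A $ i $ i), 1:])" by (simp add: t_def Bd sign_id)
    then show ?thesis using lead_coeff_prod[of "\<lambda>i. [:- (A $ i $ i), 1:]" UNIV]
      by (simp add: degree_prod_sum_eq)
  qed
  have dt: "degree (t p) < CARD('n)" if pid: "p \<noteq> id" for p
  proof -
    obtain a where a: "p a \<noteq> a" using pid by (auto simp: fun_eq_iff)
    have "degree (t p) \<le> degree (of_int (sign p) :: 'a poly) + degree (\<Prod>i\<in>UNIV. B $ i $ p i)"
      unfolding t_def by (rule degree_mult_le)
    also have "\<dots> = degree (\<Prod>i\<in>UNIV. B $ i $ p i)" by simp
    also have "\<dots> \<le> (\<Sum>i\<in>UNIV. degree (B $ i $ p i))"
      using degree_prod_sum_le[of UNIV "\<lambda>i. B $ i $ p i"] by (simp add: o_def)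
    also have "\<dots> < (\<Sum>i\<in>(UNIV::'n set). 1)"
    proof (rule sum_strict_mono_ex1)
      have "degree (B $ i $ p i) \<le> 1" for i
        using dB[of i "p i"] by (cases "i = p i") simp_all
      then show "\<forall>i\<in>UNIV. degree (B $ i $ p i) \<le> 1" by blast
      show "\<exists>i\<in>UNIV. degree (B $ i $ p i) < 1" using dB[of a "p a"] a by (intro bexI[of _ a]) auto
    qed simp
    finally show ?thesis by simp
  qed
  have "charpoly A = (\<Sum>p | p permutes UNIV. t p)"
    by (simp add: charpoly_def det_def t_def B_def)
  also have "\<dots> = t id + (\<Sum>p\<in>{p. p permutes UNIV} - {id}. t p)"
    by (rule sum.remove) (auto simp: permutes_id finite_permutations)
  finally have eq: "charpoly A = (\<Sum>p\<in>{p. p permutes UNIV} - {id}. t p) + t id" by simp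
  have less: "degree (\<Sum>p\<in>{p. p permutes UNIV} - {id}. t p) < degree (t id)"
    using tid dt by (intro degree_sum_less) auto
  have "coeff (t id) CARD('n) = 1" using tid by metis
  then show ?thesis
    using eq less tid degree_add_eq_right[OF less] by (simp add: coeff_eq_0)
qed

lemma is_eigenvalue_vector_eigenvalues: "is_eigenvalue_vector R (eigenvalues R)"
  for R :: "real ^ 'n ^ 'n"
proof -
  let ?p = "map_poly complex_of_real (charpoly R)"
  have d: "degree ?p = CARD('n)" "lead_coeff ?p = 1"
    using degree_charpoly_monic[of R] by (auto simp: degree_map_poly coeff_map_poly)
  obtain r where r: "smult (lead_coeff ?p) (\<Prod>i<degree ?p. [:- r i, 1:]) = ?p"
    by (rule complex_poly_decompose')
  have dec: "?p = (\<Prod>i\<in>{0..<CARD('n)}. [:- r i, 1:])"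
    using r unfolding d(2) unfolding d(1) by (simp add: atLeast0LessThan)
  obtain h where h: "bij_betw h (UNIV :: 'n set) {0..<CARD('n)}"
    using ex_bij_betw_finite_nat[of "UNIV :: 'n set"] by auto
  have "?p = (\<Prod>i\<in>(UNIV :: 'n set). [:- r (h i), 1:])"
    unfolding dec by (rule prod.reindex_bij_betw[OF h, symmetric])
  then have "is_eigenvalue_vector R (\<chi> i. r (h i))"
    by (simp add: is_eigenvalue_vector_def)
  then show ?thesis unfolding eigenvalues_def by (rule someI)
qed

end

theory Submission
  imports Defs
begin

text \<open>
  Write \<open>S(M)\<close> for the sum of the \<open>k \<times> k\<close> principal minors of \<open>M\<close>, \<open>DS(M)[V]\<close> for its derivative at
  \<open>M\<close> in direction \<open>V\<close>, and \<open>R0 = A + X\<close>, \<open>R1 = B + Y\<close> for the splittings into a symmetric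
  positive definite and a skew part. The operator norms of \<open>X\<close> and \<open>Y\<close> are at most \<open>\<mu>\<close>, hence at most
  \<open>\<delta>\<close> times the least eigenvalue of \<open>A\<close> and also of \<open>B\<close>.

  Everything rests on one nonvanishing principle (\<open>esym_nonzero\<close>): if the numerical range of a complex
  matrix \<open>M\<close> lies in an open half-plane bounded by a line through the origin, then \<open>S(M) \<noteq> 0\<close>. Indeed the zeros of
  \<open>s \<mapsto> det (s I + M)\<close> then lie in an open half-plane which avoids \<open>0\<close>. By the
  Gauss--Lucas argument the same is true of all its derivatives, so no coefficient vanishes, and
  \<open>S(M)\<close> is a coefficient. The numerical range of \<open>A + t B\<close> lies in the cone spanned by \<open>1\<close> and
  \<open>t\<close>, and that of \<open>X\<close> lies on the imaginary axis. This locates the zeros of certain polynomials in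
  one variable \<open>t\<close>, and each location is an inequality:

  \<^item> The zeros of \<open>S(A + t B)\<close> are negative, so \<open>S(A + t B) = S(A) \<Prod>(1 + a\<^sub>i t)\<close> with \<open>k\<close> factors and
    \<open>a\<^sub>i > 0\<close>. Here \<open>S(B) = S(A) \<Prod> a\<^sub>i\<close> and \<open>DS(A)[B] = S(A) \<Sum> a\<^sub>i\<close>, and \<open>ln a \<le> c a - 1 - ln c\<close> gives
    the concavity of \<open>ln S\<close> on positive definite matrices, in a form that holds for every slope factor
    \<open>c > 0\<close> (\<open>ln_esym_le_tangent\<close>).
  \<^item> The zeros of \<open>S(A + t X)\<close> are imaginary of modulus at least \<open>1/\<delta>\<close>, so
    \<open>S(A) \<le> S(A + X) \<le> S(A) (1 + \<delta>\<^sup>2)\<^sup>k\<close> (\<open>esym_skew_perturbation\<close>).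
  \<^item> The zeros of \<open>t \<mapsto> DS(A + t X)[B]\<close> are imaginary, so \<open>DS(A)[B] \<le> DS(A + X)[B]\<close>
    (\<open>desym_le_skew_perturbed\<close>).
  \<^item> By the second item \<open>z \<mapsto> S(A + X + z Y) - S(A)\<close> is \<open>O(\<delta>\<^sup>2) S(A)\<close> at \<open>z = 0, 1, \<dots>, k\<close>. It has degree at
    most \<open>k\<close>, so its derivative \<open>DS(A + X)[Y]\<close> at \<open>z = 0\<close> is \<open>O(\<delta>\<^sup>2) S(A)\<close> as well
    (\<open>desym_skew_skew_bound\<close>).

  These are combined in \<open>ln_esym_d_concave\<close>. The difficulty there is that \<open>B\<close> may be arbitrarily large
  compared with \<open>A\<close>, so that replacing \<open>DS(A)[B]/S(A)\<close> by \<open>DS(R0)[B]/S(R0)\<close> may cost a term of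
  size \<open>\<delta>\<^sup>2 DS(A)[B]/S(A)\<close>, which is unbounded. The factor \<open>c = (1 + \<delta>\<^sup>2)\<^sup>-\<^sup>k\<close> in the concavity
  inequality absorbs this loss at the bounded price
  \<open>- k ln c = O(\<delta>\<^sup>2)\<close>, and Euler's identity \<open>DS(R0)[R0] = k S(R0)\<close> turns what remains into the
  tangent at \<open>R0\<close>.
\<close>

section \<open>Polynomials with zeros in a half-plane or on a line\<close>

lemma Re_mult_inverse_pos:
  assumes "0 < Re (\<zeta> * w)"
  shows "0 < Re (cnj \<zeta> * (1 / w))"
proof -
  have "w \<noteq> 0" using assms by auto
  have "cnj \<zeta> * (1 / w) = cnj (\<zeta> * w) / (cmod w)\<^sup>2"
    by (simp add: complex_norm_square \<open>w \<noteq> 0\<close> del: of_real_power)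
  then have "Re (cnj \<zeta> * (1 / w)) = Re (\<zeta> * w) / (cmod w)\<^sup>2"
    by (simp only: Re_divide_of_real cnj.simps)
  then show ?thesis using assms \<open>w \<noteq> 0\<close> by simp
qed

text \<open>The logarithmic derivative is the sum of \<open>1 / (z - r)\<close> over the zeros \<open>r\<close>. By the assumption each
  \<open>z - r\<close> lies in the half-plane \<open>0 < Re (\<zeta> * w)\<close>, and the reciprocals of its points form the half-plane
  \<open>0 < Re (cnj \<zeta> * w)\<close>. In particular the derivative has no zero with \<open>0 \<le> Re (\<zeta> * z)\<close>, which is the
  Gauss--Lucas theorem for a half-plane.\<close>

lemma half_plane_log_deriv_pos:
  fixes p :: "complex poly"
  assumes "\<And>z. 0 \<le> Re (\<zeta> * z) \<Longrightarrow> poly p z \<noteq> 0" and "0 < degree p" and "0 \<le> Re (\<zeta> * z)"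
  shows "0 < Re (cnj \<zeta> * (poly (pderiv p) z / poly p z))"
  using assms(1,2)
proof (induction "degree p" arbitrary: p)
  case 0
  then show ?case by simp
next
  case (Suc d)
  have "\<not> constant (poly p)" using Suc.hyps(2) by (simp add: constant_degree)
  then obtain r where r: "poly p r = 0" using fundamental_theorem_of_algebra by blast
  then obtain q where q: "p = [:- r, 1:] * q" by (auto simp: poly_eq_0_iff_dvd elim: dvdE)
  have q0: "q \<noteq> 0" using q Suc.hyps(2) by auto
  then have dq: "d = degree q" using Suc.hyps(2) q degree_mult_eq[of "[:- r, 1:]" q] by simp
  have qn: "poly q w \<noteq> 0" if "0 \<le> Re (\<zeta> * w)" for w using Suc.prems(1)[OF that] q by simp
  have rn: "0 < Re (\<zeta> * (z - r))" using Suc.prems(1)[of r] r assms(3)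
    by (force simp: right_diff_distrib)
  then have "z \<noteq> r" by auto
  have "poly (pderiv p) z / poly p z = 1 / (z - r) + poly (pderiv q) z / poly q z"
    using qn[OF assms(3)] \<open>z \<noteq> r\<close>
    unfolding q pderiv_mult by (simp add: pderiv_pCons) (simp add: field_simps)
  moreover have "0 \<le> Re (cnj \<zeta> * (poly (pderiv q) z / poly q z))"
  proof (cases "degree q = 0")
    case True
    then have "pderiv q = 0" by (simp add: pderiv_eq_0_iff)
    then show ?thesis by simp
  qed (use Suc.hyps(1)[OF dq] qn in fastforce)
  ultimately show ?case using Re_mult_inverse_pos[OF rn] by (simp add: distrib_left)
qed

text \<open>Up to a factorial, \<open>coeff p j\<close> is the value at \<open>0\<close> of the \<open>j\<close>-th derivative, and the hypothesis is
  inherited by derivatives.\<close>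

lemma half_plane_coeff_nonzero:
  fixes p :: "complex poly"
  assumes "\<And>z. 0 \<le> Re (\<zeta> * z) \<Longrightarrow> poly p z \<noteq> 0" and "j \<le> degree p"
  shows "coeff p j \<noteq> 0"
  using assms
proof (induction j arbitrary: p)
  case 0
  then show ?case using "0"(1)[of 0] by (simp add: poly_0_coeff_0)
next
  case (Suc j)
  have "poly (pderiv p) z \<noteq> 0" if "0 \<le> Re (\<zeta> * z)" for z
    using half_plane_log_deriv_pos[of \<zeta> p z] Suc.prems that by fastforce
  then have "coeff (pderiv p) j \<noteq> 0" using Suc.prems(2)
    by (intro Suc.IH) (auto simp: degree_pderiv)
  then show ?case by (simp add: coeff_pderiv)
qed

text \<open>Normalising by the value at \<open>0\<close> instead of the leading coefficient lets the number of factors drop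
  below the expected degree without any case distinction.\<close>

lemma poly_eq_prod_reciprocal_roots:
  fixes p :: "complex poly"
  assumes "poly p 0 \<noteq> 0"
  obtains c where "\<And>z. poly p z = poly p 0 * (\<Prod>i<degree p. 1 + c i * z)"
    and "\<And>i. i < degree p \<Longrightarrow> c i \<noteq> 0 \<and> poly p (- 1 / c i) = 0"
proof -
  obtain r where r: "smult (lead_coeff p) (\<Prod>i<degree p. [:- r i, 1:]) = p"
    by (rule complex_poly_decompose')
  have ev: "poly p z = lead_coeff p * (\<Prod>i<degree p. z - r i)" for z
    by (subst r[symmetric]) (simp add: poly_prod)
  have root: "poly p (r i) = 0" if "i < degree p" for i
    using that by (auto simp: ev)
  then have rn: "r i \<noteq> 0" if "i < degree p" for i using assms that by metis
  have "poly p z = poly p 0 * (\<Prod>i<degree p. 1 + (- 1 / r i) * z)" for z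
  proof -
    have "(\<Prod>i<degree p. z - r i) = (\<Prod>i<degree p. (0 - r i) * (1 + (- 1 / r i) * z))"
      by (rule prod.cong) (use rn in \<open>auto simp: field_simps\<close>)
    also have "\<dots> = (\<Prod>i<degree p. 0 - r i) * (\<Prod>i<degree p. 1 + (- 1 / r i) * z)"
      by (rule prod.distrib)
    finally show ?thesis by (simp add: ev)
  qed
  moreover have "- 1 / r i \<noteq> 0 \<and> poly p (- 1 / (- 1 / r i)) = 0" if "i < degree p" for i
    using root rn that by simp
  ultimately show thesis by (rule that)
qed

lemma real_poly_pos_at_0:
  fixes p :: "real poly"
  assumes "0 < lead_coeff p" and "\<And>x. 0 \<le> x \<Longrightarrow> poly p x \<noteq> 0"
  shows "0 < poly p 0"
proof (rule ccontr)
  assume "\<not> 0 < poly p 0"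
  then have neg: "poly p 0 < 0" using assms(2)[of 0] by force
  obtain m where m: "\<forall>x\<ge>m. lead_coeff p \<le> poly p x" using poly_pinfty_gt_lc[OF assms(1)] by blast
  then have pos: "0 < poly p (max m 1)" using assms(1) by (smt (verit) max.cobounded1)
  show False using poly_IVT_pos[of 0 "max m 1" p] neg pos assms(2) by force
qed

text \<open>A Markov-type inequality with an unspecified constant: by Lagrange interpolation a polynomial of degree
  at most \<open>k\<close> is a combination, with fixed polynomials, of its values at \<open>0, 1, \<dots>, k\<close>.\<close>

lemma coeff_1_bound_by_node_values:
  fixes k :: nat
  shows "\<exists>C\<ge>0. \<forall>p M. degree p \<le> k \<longrightarrow> (\<forall>j\<le>k. \<bar>poly p (real j)\<bar> \<le> M) \<longrightarrow> \<bar>coeff p 1\<bar> \<le> C * M"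
proof -
  define L :: "nat \<Rightarrow> real poly" where
    "L j = (\<Prod>i\<in>{..k} - {j}. smult (1 / (real j - real i)) [:- real i, 1:])" for j
  define C where "C = (\<Sum>j\<le>k. \<bar>coeff (L j) 1\<bar>)"
  have Lval: "poly (L j) (real i) = (if i = j then 1 else 0)" if "i \<le> k" for i j
    using that by (auto simp: L_def poly_prod divide_simps intro!: prod.neutral)
  have Ldeg: "degree (L j) \<le> k" if "j \<le> k" for j
  proof -
    have "degree (L j) \<le> (\<Sum>i\<in>{..k} - {j}. degree (smult (1 / (real j - real i)) [:- real i, 1:]))"
      unfolding L_def
      using degree_prod_sum_le[of "{..k} - {j}" "\<lambda>i. smult (1 / (real j - real i)) [:- real i, 1:]"]
      unfolding o_def by simp
    also have "\<dots> \<le> (\<Sum>i\<in>{..k} - {j}. 1)" by (rule sum_mono) simp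
    finally show ?thesis using that by simp
  qed
  have "\<bar>coeff p 1\<bar> \<le> C * M"
    if p: "degree p \<le> k" and M: "\<forall>j\<le>k. \<bar>poly p (real j)\<bar> \<le> M" for p M
  proof -
    have "p = (\<Sum>j\<le>k. smult (poly p (real j)) (L j))"
    proof (rule poly_eqI_degree)
      show "poly p x = poly (\<Sum>j\<le>k. smult (poly p (real j)) (L j)) x" if x: "x \<in> real ` {..k}" for x
      proof -
        obtain i where i: "x = real i" "i \<le> k" using x by auto
        have "poly (\<Sum>j\<le>k. smult (poly p (real j)) (L j)) x
            = (\<Sum>j\<le>k. if j = i then poly p (real i) else 0)"
          unfolding poly_sum using i by (intro sum.cong) (auto simp: Lval)
        then show ?thesis using i by simp
      qed
      have card: "card (real ` {..k}) = Suc k" by (simp add: card_image)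
      then show "degree p < card (real ` {..k})" using p by simp
      have "degree (\<Sum>j\<le>k. smult (poly p (real j)) (L j)) \<le> k"
        by (rule degree_sum_le) (auto intro: order_trans[OF degree_smult_le] Ldeg)
      then show "degree (\<Sum>j\<le>k. smult (poly p (real j)) (L j)) < card (real ` {..k})" using card by simp
    qed
    then have "coeff p 1 = (\<Sum>j\<le>k. poly p (real j) * coeff (L j) 1)"
      by (metis (no_types, lifting) coeff_smult coeff_sum sum.cong)
    also have "\<bar>\<dots>\<bar> \<le> (\<Sum>j\<le>k. M * \<bar>coeff (L j) 1\<bar>)"
      by (rule order_trans[OF sum_abs]) (auto intro!: sum_mono mult_right_mono simp: abs_mult M)
    finally show ?thesis by (simp add: C_def sum_distrib_left mult.commute)
  qed
  moreover have "0 \<le> C" by (simp add: C_def sum_nonneg)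
  ultimately show ?thesis by blast
qed

text \<open>All factors \<open>1 + c t\<close> of \<open>p t / p 0\<close> have \<open>c\<close> imaginary, so at \<open>t = 1\<close> their moduli are
  \<open>sqrt (1 + \<bar>c\<bar>\<^sup>2)\<close>. If moreover the zeros have modulus at least \<open>1 / \<theta>\<close>, then \<open>\<bar>c\<bar> \<le> \<theta>\<close>; writing this as
  \<open>1 \<le> cmod t * \<theta>\<close> includes the case \<open>\<theta> = 0\<close>, in which there is no zero.\<close>

lemma imaginary_roots_modulus_bounds:
  fixes p :: "complex poly"
  assumes p0: "poly p 0 \<noteq> 0" and im: "\<And>t. poly p t = 0 \<Longrightarrow> Re t = 0"
  shows imaginary_roots_modulus_ge: "cmod (poly p 0) \<le> cmod (poly p 1)"
    and imaginary_roots_modulus_le: "(\<And>t. poly p t = 0 \<Longrightarrow> 1 \<le> cmod t * \<theta>) \<Longrightarrow>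
      cmod (poly p 1) \<le> cmod (poly p 0) * (1 + \<theta>\<^sup>2) ^ degree p"
proof -
  obtain d where d: "\<And>z. poly p z = poly p 0 * (\<Prod>i<degree p. 1 + d i * z)"
    and root: "\<And>i. i < degree p \<Longrightarrow> d i \<noteq> 0 \<and> poly p (- 1 / d i) = 0"
    using poly_eq_prod_reciprocal_roots[OF p0] by metis
  have val: "cmod (poly p 1) = cmod (poly p 0) * (\<Prod>i<degree p. cmod (1 + d i))"
    using d[of 1] by (simp add: norm_mult prod_norm)
  have sq: "(cmod (1 + d i))\<^sup>2 = 1 + (cmod (d i))\<^sup>2" if i: "i < degree p" for i
  proof -
    have "Re (- 1 / d i) = 0" using im root[OF i] by blast
    then have "Re (d i) = 0" by (auto simp: Re_divide sum_power2_eq_zero_iff)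
    then show ?thesis by (simp add: cmod_power2)
  qed
  have ge: "1 \<le> cmod (1 + d i)" if "i < degree p" for i
  proof (rule power2_le_imp_le)
    show "1\<^sup>2 \<le> (cmod (1 + d i))\<^sup>2" unfolding sq[OF that] by simp
  qed simp
  have "1 \<le> (\<Prod>i<degree p. cmod (1 + d i))" using ge by (intro prod_ge_1) auto
  then show "cmod (poly p 0) \<le> cmod (poly p 1)"
    unfolding val by (simp add: mult_le_cancel_left1)
  assume far: "\<And>t. poly p t = 0 \<Longrightarrow> 1 \<le> cmod t * \<theta>"
  have "cmod (1 + d i) \<le> 1 + \<theta>\<^sup>2" if i: "i < degree p" for i
  proof -
    have "1 \<le> cmod (- 1 / d i) * \<theta>" using far root[OF i] by blast
    then have "cmod (d i) \<le> \<theta>" using root[OF i] by (simp add: norm_divide field_simps)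
    then have "(cmod (d i))\<^sup>2 \<le> \<theta>\<^sup>2" by (intro power_mono) auto
    then have "(cmod (1 + d i))\<^sup>2 \<le> 1 + \<theta>\<^sup>2" using sq[OF i] by simp
    \<comment> \<open>giving away a square root here keeps all later bounds polynomial\<close>
    also have "\<dots> \<le> (1 + \<theta>\<^sup>2)\<^sup>2" by (rule self_le_power) auto
    finally show ?thesis by (rule power2_le_imp_le) simp
  qed
  then have "(\<Prod>i<degree p. cmod (1 + d i)) \<le> (\<Prod>i<degree p. 1 + \<theta>\<^sup>2)"
    by (intro prod_mono) auto
  then show "cmod (poly p 1) \<le> cmod (poly p 0) * (1 + \<theta>\<^sup>2) ^ degree p"
    unfolding val by (intro mult_left_mono) auto
qed

text \<open>The left-hand side is convex in \<open>t\<close> and the right-hand side is the chord over \<open>[0,1]\<close>.\<close>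

lemma power_one_plus_scaled_le:
  fixes b t :: real
  assumes "0 \<le> b" and "0 \<le> t" and "t \<le> 1"
  shows "(1 + b * t) ^ k \<le> 1 + t * ((1 + b) ^ k - 1)"
proof (induction k)
  case (Suc k)
  have P: "1 \<le> (1 + b) ^ k" using assms by simp
  have "t * t \<le> t" using mult_left_mono[OF assms(3,2)] by simp
  then have "(b * ((1 + b) ^ k - 1)) * (t * t) \<le> (b * ((1 + b) ^ k - 1)) * t"
    using assms P by (intro mult_left_mono) auto
  moreover have "(1 + b * t) ^ Suc k \<le> (1 + b * t) * (1 + t * ((1 + b) ^ k - 1))"
    using Suc assms by (simp add: mult_left_mono)
  ultimately show ?case by (simp add: algebra_simps)
qed simp

section \<open>Sums of principal minors as polynomials in the entries\<close>

text \<open>The inner sum is the principal minor with index set \<open>I\<close>, written by the Leibniz formula. Working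
  over an arbitrary commutative ring allows real, complex and polynomial entries.\<close>

definition esym :: "nat \<Rightarrow> 'a::comm_ring_1 ^ 'n ^ 'n \<Rightarrow> 'a" where
  "esym k M = (\<Sum>I | card I = k. \<Sum>p | p permutes I. of_int (sign p) * (\<Prod>i\<in>I. M $ i $ p i))"

text \<open>The derivative of \<^term>\<open>esym k\<close> at \<open>M\<close> in direction \<open>V\<close>, by the product rule. The explicit formula makes
  sense over any ring; \<open>coeff_line_poly_1\<close> below says that it is the derivative.\<close>

definition desym :: "nat \<Rightarrow> 'a::comm_ring_1 ^ 'n ^ 'n \<Rightarrow> 'a ^ 'n ^ 'n \<Rightarrow> 'a" where
  "desym k M V = (\<Sum>I | card I = k. \<Sum>p | p permutes I.
     of_int (sign p) * (\<Sum>i\<in>I. V $ i $ p i * (\<Prod>j\<in>I - {i}. M $ j $ p j)))"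

lemma permutes_subset_iff_fixes:
  assumes "p permutes (UNIV :: 'n set)"
  shows "p permutes I \<longleftrightarrow> (\<forall>i. i \<notin> I \<longrightarrow> p i = i)"
  using assms by (auto simp: permutes_def)

text \<open>In the Leibniz formula for the left-hand side choose from every factor either the scalar or the entry of
  \<open>M\<close>. If the entries are chosen in the rows \<open>I\<close>, a permutation contributes only if it fixes the complement
  of \<open>I\<close>, which is to say that it permutes \<open>I\<close>.\<close>

lemma det_scalar_add_eq_sum_esym:
  fixes M :: "'a::comm_ring_1 ^ 'n ^ 'n"
  shows "det (\<chi> i j. (if i = j then s else 0) + M $ i $ j) = (\<Sum>k\<le>CARD('n). esym k M * s ^ (CARD('n) - k))"
proof -
  let ?P = "{p. p permutes (UNIV :: 'n set)}"
  let ?t = "\<lambda>p I. of_int (sign p) * (\<Prod>i\<in>I. M $ i $ p i)"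
  have scal: "(\<Prod>i\<in>UNIV - I. if i = p i then s else 0) = (if p permutes I then s ^ (CARD('n) - card I) else 0)"
    if p: "p permutes UNIV" for p and I :: "'n set"
  proof (cases "p permutes I")
    case True
    then have "(\<Prod>i\<in>UNIV - I. if i = p i then s else 0) = (\<Prod>i\<in>UNIV - I. s)"
      by (intro prod.cong) (auto simp: permutes_def)
    then show ?thesis using True by (simp add: card_Diff_subset)
  next
    case False
    then obtain i where "i \<notin> I" "p i \<noteq> i" using permutes_subset_iff_fixes[OF p] by blast
    then have "(\<Prod>i\<in>UNIV - I. if i = p i then s else 0) = 0"
      by (intro prod_zero bexI[of _ i]) auto
    then show ?thesis using False by simp
  qed
  have "det (\<chi> i j. (if i = j then s else 0) + M $ i $ j)
      = (\<Sum>p\<in>?P. of_int (sign p) * (\<Prod>i\<in>UNIV. M $ i $ p i + (if i = p i then s else 0)))"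
    by (simp add: det_def add.commute)
  also have "\<dots> = (\<Sum>p\<in>?P. \<Sum>I\<in>UNIV. if p permutes I then ?t p I * s ^ (CARD('n) - card I) else 0)"
    by (intro sum.cong) (auto simp: prod_add sum_distrib_left mult.assoc scal intro!: sum.cong)
  also have "\<dots> = (\<Sum>I\<in>UNIV. \<Sum>p\<in>?P. if p permutes I then ?t p I * s ^ (CARD('n) - card I) else 0)"
    by (rule sum.swap)
  also have "\<dots> = (\<Sum>I\<in>UNIV. \<Sum>p | p permutes I. ?t p I * s ^ (CARD('n) - card I))"
    by (intro sum.cong sum.mono_neutral_cong_right)
      (auto simp: finite_permutations intro: permutes_subset)
  also have "\<dots> = (\<Sum>k\<le>CARD('n). \<Sum>I | I \<in> UNIV \<and> card I = k. \<Sum>p | p permutes I. ?t p I * s ^ (CARD('n) - card I))"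
    by (rule sum.group[symmetric]) (auto intro: card_mono)
  also have "\<dots> = (\<Sum>k\<le>CARD('n). esym k M * s ^ (CARD('n) - k))"
    by (simp add: esym_def sum_distrib_right)
  finally show ?thesis .
qed

lemma coeff_eq_of_power_sums:
  fixes a b :: "nat \<Rightarrow> complex"
  assumes "\<And>s. (\<Sum>k\<le>n. a k * s ^ (n - k)) = (\<Sum>k\<le>n. b k * s ^ (n - k))" and "k \<le> n"
  shows "a k = b k"
proof -
  have rev: "(\<Sum>k\<le>n. f k * s ^ (n - k)) = (\<Sum>k\<le>n. f (n - k) * s ^ k)" for f :: "nat \<Rightarrow> complex" and s
    by (rule sum.reindex_bij_witness[of _ "\<lambda>k. n - k" "\<lambda>k. n - k"]) auto
  have "\<forall>i\<le>n. a (n - i) = b (n - i)"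
    using assms(1) unfolding rev
    by (intro allI impI polyfun_eq_coeffs[of "\<lambda>i. a (n - i)" n "\<lambda>i. b (n - i)", THEN iffD1, rule_format])
  then show ?thesis using assms(2) by (metis diff_diff_cancel diff_le_self)
qed

lemma esym_of_real:
  "esym k (\<chi> i j. of_real (R $ i $ j)) = (of_real (esym k R) :: 'a::{real_algebra_1,comm_ring_1})"
  by (simp add: esym_def)

lemma desym_of_real:
  "desym k (\<chi> i j. of_real (R $ i $ j)) (\<chi> i j. of_real (V $ i $ j)) =
    (of_real (desym k R V) :: 'a::{real_algebra_1,comm_ring_1})"
  by (simp add: desym_def)

lemma esym_mat_1: "esym k (mat 1 :: 'a::comm_ring_1 ^ 'n ^ 'n) = of_nat (CARD('n) choose k)"
proof -
  have "(\<Sum>p | p permutes I. of_int (sign p) * (\<Prod>i\<in>I. (mat 1 :: 'a ^ 'n ^ 'n) $ i $ p i)) = 1" for I :: "'n set"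
  proof -
    have "(\<Prod>i\<in>I. (mat 1 :: 'a ^ 'n ^ 'n) $ i $ p i) = 0" if p: "p permutes I" "p \<noteq> id" for p
    proof -
      obtain i where "p i \<noteq> i" using p(2) by (auto simp: fun_eq_iff)
      moreover from this have "i \<in> I" using p(1) by (auto simp: permutes_def)
      ultimately show ?thesis by (intro prod_zero bexI[of _ i]) (auto simp: mat_def)
    qed
    then have "(\<Sum>p | p permutes I. of_int (sign p) * (\<Prod>i\<in>I. (mat 1 :: 'a ^ 'n ^ 'n) $ i $ p i))
        = (\<Sum>p\<in>{id}. of_int (sign p) * (\<Prod>i\<in>I. (mat 1 :: 'a ^ 'n ^ 'n) $ i $ p i))"
      by (intro sum.mono_neutral_right) (auto simp: finite_permutations permutes_id)
    then show ?thesis by (simp add: mat_def sign_id)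
  qed
  then have "esym k (mat 1 :: 'a ^ 'n ^ 'n) = of_nat (card {I :: 'n set. card I = k})"
    by (simp add: esym_def)
  then show ?thesis using n_subsets[of "UNIV :: 'n set" k] by simp
qed

text \<open>Euler's identity for a homogeneous polynomial of degree \<open>k\<close>.\<close>

lemma desym_self: "desym k M M = of_nat k * esym k M"
proof -
  have "(\<Sum>i\<in>I. M $ i $ p i * (\<Prod>j\<in>I - {i}. M $ j $ p j)) = of_nat (card I) * (\<Prod>i\<in>I. M $ i $ p i)"
    for I and p :: "'b \<Rightarrow> 'b"
  proof -
    have "(\<Sum>i\<in>I. M $ i $ p i * (\<Prod>j\<in>I - {i}. M $ j $ p j)) = (\<Sum>i\<in>I. \<Prod>i\<in>I. M $ i $ p i)"
      by (intro sum.cong) (auto simp: prod.remove)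
    then show ?thesis by simp
  qed
  then show ?thesis by (auto simp: desym_def esym_def sum_distrib_left mult.left_commute intro!: sum.cong)
qed

lemma desym_add_right: "desym k M (V + W) = desym k M V + desym k M W"
  by (simp add: desym_def distrib_right distrib_left sum.distrib)

lemma desym_diff_right: "desym k M (V - W) = desym k M V - desym k M W"
  using desym_add_right[of k M "V - W" W] by simp

lemma desym_eq_sum_entries:
  fixes M V :: "'a::comm_ring_1 ^ 'n ^ 'n"
  shows "desym k M V = (\<Sum>a\<in>UNIV. \<Sum>b\<in>UNIV. desym k M (\<chi> p q. if p = a \<and> q = b then 1 else 0) * V $ a $ b)"
proof -
  have add: "desym k M (\<Sum>a\<in>A. f a) = (\<Sum>a\<in>A. desym k M (f a))" if "finite A" for A :: "'n set" and f
    using that by induction (simp_all add: desym_add_right, simp add: desym_def)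
  have scale: "desym k M (\<chi> p q. if p = a \<and> q = b then V $ a $ b else 0)
      = desym k M (\<chi> p q. if p = a \<and> q = b then 1 else 0) * V $ a $ b" for a b
    by (auto simp: desym_def sum_distrib_left sum_distrib_right intro!: sum.cong)
  have "V = (\<Sum>a\<in>UNIV. \<Sum>b\<in>UNIV. (\<chi> p q. if p = a \<and> q = b then V $ a $ b else 0))"
  proof -
    have "(\<Sum>a\<in>UNIV. \<Sum>b\<in>UNIV. if p = a \<and> q = b then V $ a $ b else 0) = V $ p $ q" for p q
    proof -
      have "(\<Sum>a\<in>UNIV. \<Sum>b\<in>UNIV. if p = a \<and> q = b then V $ a $ b else 0)
          = (\<Sum>a\<in>UNIV. if a = p then \<Sum>b\<in>UNIV. if b = q then V $ p $ b else 0 else 0)"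
        by (intro sum.cong) auto
      then show ?thesis by simp
    qed
    then show ?thesis by (simp add: vec_eq_iff sum_component)
  qed
  then have "desym k M V = desym k M (\<Sum>a\<in>UNIV. \<Sum>b\<in>UNIV. (\<chi> p q. if p = a \<and> q = b then V $ a $ b else 0))"
    by simp
  then show ?thesis by (simp only: add finite scale)
qed

lemma coeff_1_prod_linear:
  fixes a b :: "'i \<Rightarrow> 'a::idom"
  shows "coeff (\<Prod>i\<in>I. [:a i, b i:]) 1 = (\<Sum>i\<in>I. b i * (\<Prod>j\<in>I - {i}. a j))"
proof -
  have "coeff p 1 = poly (pderiv p) 0" for p :: "'a poly"
    by (simp add: poly_0_coeff_0 coeff_pderiv)
  then show ?thesis
    by (simp add: pderiv_prod poly_sum poly_prod pderiv_pCons mult.commute)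
qed

lemma prod_linear_degree_coeff:
  fixes a b :: "'i \<Rightarrow> 'a::idom"
  assumes "finite I"
  shows degree_prod_linear: "degree (\<Prod>i\<in>I. [:a i, b i:]) \<le> card I"
    and coeff_top_prod_linear: "coeff (\<Prod>i\<in>I. [:a i, b i:]) (card I) = (\<Prod>i\<in>I. b i)"
proof -
  have "degree (\<Prod>i\<in>I. [:a i, b i:]) \<le> card I \<and> coeff (\<Prod>i\<in>I. [:a i, b i:]) (card I) = (\<Prod>i\<in>I. b i)"
    using assms
  proof (induction I rule: finite_induct)
    case (insert x I)
    let ?q = "\<Prod>i\<in>I. [:a i, b i:]"
    have "degree ([:a x, b x:] * ?q) \<le> 1 + card I"
      by (rule order_trans[OF degree_mult_le]) (use insert.IH in \<open>intro add_mono; simp\<close>)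
    moreover have "coeff ([:a x, b x:] * ?q) (Suc (card I)) = b x * coeff ?q (card I)"
      using insert.IH by (simp add: coeff_eq_0)
    ultimately show ?case using insert by simp
  qed simp
  then show "degree (\<Prod>i\<in>I. [:a i, b i:]) \<le> card I"
    and "coeff (\<Prod>i\<in>I. [:a i, b i:]) (card I) = (\<Prod>i\<in>I. b i)" by auto
qed

definition line_poly :: "nat \<Rightarrow> 'a::comm_ring_1 ^ 'n ^ 'n \<Rightarrow> 'a ^ 'n ^ 'n \<Rightarrow> 'a poly" where
  "line_poly k A B = esym k (\<chi> i j. [:A $ i $ j, B $ i $ j:])"

text \<open>Derivative in direction \<open>B\<close> along the line \<open>A + t X\<close>, as a polynomial in \<open>t\<close>.\<close>

definition dline_poly :: "nat \<Rightarrow> 'a::comm_ring_1 ^ 'n ^ 'n \<Rightarrow> 'a ^ 'n ^ 'n \<Rightarrow> 'a ^ 'n ^ 'n \<Rightarrow> 'a poly" where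
  "dline_poly k A X B = desym k (\<chi> i j. [:A $ i $ j, X $ i $ j:]) (\<chi> i j. [:B $ i $ j:])"

lemma poly_line_poly: "poly (line_poly k A B) t = esym k (\<chi> i j. A $ i $ j + t * B $ i $ j)"
  by (simp add: line_poly_def esym_def poly_sum poly_prod)

lemma poly_dline_poly: "poly (dline_poly k A X B) t = desym k (\<chi> i j. A $ i $ j + t * X $ i $ j) B"
  by (simp add: dline_poly_def desym_def poly_sum poly_prod)

lemma coeff_line_poly_0: "coeff (line_poly k A B) 0 = esym k A"
  using poly_line_poly[of k A B 0] by (simp add: poly_0_coeff_0)

lemma coeff_line_poly_1:
  fixes A :: "'a::idom ^ 'n ^ 'n"
  shows "coeff (line_poly k A B) 1 = desym k A B"
proof -
  have "coeff (of_int m * p) 1 = of_int m * coeff p 1" for m and p :: "'a poly"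
    by (simp add: of_int_poly)
  then show ?thesis
    unfolding line_poly_def esym_def desym_def coeff_sum
    by (intro sum.cong refl) (simp only: vec_lambda_beta coeff_1_prod_linear)
qed

lemma degree_line_poly:
  fixes A :: "'a::idom ^ 'n ^ 'n"
  shows "degree (line_poly k A B) \<le> k"
  unfolding line_poly_def esym_def
  by (intro degree_sum_le)
    (auto simp: finite_permutations of_int_poly
      intro!: degree_sum_le order_trans[OF degree_smult_le] order_trans[OF degree_prod_linear])

lemma coeff_line_poly_top:
  fixes A :: "'a::idom ^ 'n ^ 'n"
  shows "coeff (line_poly k A B) k = esym k B"
  unfolding line_poly_def esym_def coeff_sum
  by (intro sum.cong refl) (auto simp: of_int_poly coeff_top_prod_linear)

section \<open>Numerical ranges\<close>

definition cmat :: "real ^ 'n ^ 'n \<Rightarrow> complex ^ 'n ^ 'n" where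
  "cmat R = (\<chi> i j. complex_of_real (R $ i $ j))"

definition qform :: "complex ^ 'n ^ 'n \<Rightarrow> complex ^ 'n \<Rightarrow> complex" where
  "qform M v = (\<Sum>i\<in>UNIV. \<Sum>j\<in>UNIV. cnj (v $ i) * M $ i $ j * v $ j)"

text \<open>The numerical range of \<open>M\<close> lies in the open half-plane \<open>0 < Re (\<zeta> * w)\<close>.\<close>

definition sectorial :: "complex \<Rightarrow> complex ^ 'n ^ 'n \<Rightarrow> bool" where
  "sectorial \<zeta> M \<longleftrightarrow> (\<forall>v. v \<noteq> 0 \<longrightarrow> 0 < Re (\<zeta> * qform M v))"

abbreviation mline :: "'a::comm_ring_1 ^ 'n ^ 'n \<Rightarrow> 'a \<Rightarrow> 'a ^ 'n ^ 'n \<Rightarrow> 'a ^ 'n ^ 'n" where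
  "mline M t N \<equiv> (\<chi> i j. M $ i $ j + t * N $ i $ j)"

lemma Re_mult_of_real: "Re (z * of_real r) = Re z * r"
  by simp

lemma esym_cmat: "esym k (cmat R) = of_real (esym k R)"
  by (simp add: cmat_def esym_of_real)

lemma desym_cmat: "desym k (cmat R) (cmat V) = of_real (desym k R V)"
  by (simp add: cmat_def desym_of_real)

lemma cmat_mline: "mline (cmat A) (of_real t) (cmat B) = cmat (mline A t B)"
  by (simp add: cmat_def)

lemma mline_real: "mline A t B = A + t *\<^sub>R B" for A :: "real ^ 'n ^ 'n"
  by (simp add: vec_eq_iff)

lemma qform_mline: "qform (mline M t N) v = qform M v + t * qform N v"
  by (simp add: qform_def algebra_simps sum.distrib sum_distrib_left)

lemma qform_scalar: "qform (\<chi> i j. if i = j then s else 0) v = s * of_real ((norm v)\<^sup>2)"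
proof -
  have "qform (\<chi> i j. if i = j then s else 0) v = (\<Sum>i\<in>UNIV. s * of_real ((norm (v $ i))\<^sup>2))"
    unfolding qform_def
  proof (rule sum.cong)
    fix i
    have "(\<Sum>j\<in>UNIV. cnj (v $ i) * (\<chi> i j. if i = j then s else 0) $ i $ j * v $ j)
        = (\<Sum>j\<in>UNIV. if j = i then cnj (v $ i) * s * v $ i else 0)"
      by (rule sum.cong) auto
    also have "\<dots> = s * of_real ((norm (v $ i))\<^sup>2)"
      by (simp add: complex_norm_square del: of_real_power)
    finally show "(\<Sum>j\<in>UNIV. cnj (v $ i) * (\<chi> i j. if i = j then s else 0) $ i $ j * v $ j)
        = s * of_real ((norm (v $ i))\<^sup>2)" .
  qed simp
  then show ?thesis by (simp add: norm_vec_def L2_set_def sum_nonneg sum_distrib_left)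
qed

text \<open>A null vector \<open>v\<close> of \<open>s I + M\<close> would give \<open>s \<bar>v\<bar>\<^sup>2 = - qform M v\<close>, with the two sides on different sides of
  the line bounding the half-plane.\<close>

lemma det_scalar_add_nonzero:
  fixes M :: "complex ^ 'n ^ 'n"
  assumes "sectorial \<zeta> M" and "0 \<le> Re (\<zeta> * s)"
  shows "det (\<chi> i j. (if i = j then s else 0) + M $ i $ j) \<noteq> 0"
proof -
  let ?N = "\<chi> i j. (if i = j then s else 0) + M $ i $ j"
  have "v = 0" if v: "?N *v v = 0" for v
  proof (rule ccontr)
    assume nz: "v \<noteq> 0"
    have "qform ?N v = (\<Sum>i\<in>UNIV. cnj (v $ i) * (?N *v v) $ i)"
      by (simp add: qform_def matrix_vector_mult_def sum_distrib_left mult.assoc)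
    then have "qform ?N v = 0" by (simp only: v) simp
    moreover have "qform ?N v = s * of_real ((norm v)\<^sup>2) + qform M v"
      using qform_mline[of "\<chi> i j. if i = j then s else 0" 1 M v] by (simp add: qform_scalar)
    ultimately have "\<zeta> * s * of_real ((norm v)\<^sup>2) + \<zeta> * qform M v = 0"
      by (metis distrib_left mult.assoc mult_zero_right)
    then have "0 = Re (\<zeta> * s) * (norm v)\<^sup>2 + Re (\<zeta> * qform M v)"
      by (metis Re_mult_of_real plus_complex.sel(1) zero_complex.sel(1))
    moreover have "0 < Re (\<zeta> * qform M v)" using assms(1) nz by (simp add: sectorial_def)
    ultimately show False using assms(2) by (smt (verit) mult_nonneg_nonneg zero_le_power2)
  qed
  then have "invertible ?N"
    unfolding invertible_left_inverse matrix_left_invertible_ker by blast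
  then show ?thesis by (simp add: invertible_det_nz)
qed

text \<open>By \<open>det_scalar_add_nonzero\<close> the polynomial \<open>det (s I + M)\<close> in \<open>s\<close> has its zeros in a half-plane that
  excludes \<open>0\<close>, and \<open>esym k M\<close> is its coefficient of index \<open>n - k\<close>.\<close>

lemma esym_nonzero:
  fixes M :: "complex ^ 'n ^ 'n"
  assumes "sectorial \<zeta> M" and "k \<le> CARD('n)"
  shows "esym k M \<noteq> 0"
proof -
  define p where "p = (\<Sum>k\<le>CARD('n). monom (esym k M) (CARD('n) - k))"
  have ev: "poly p s = det (\<chi> i j. (if i = j then s else 0) + M $ i $ j)" for s
    by (simp add: p_def poly_sum poly_monom det_scalar_add_eq_sum_esym)
  have co: "coeff p (CARD('n) - j) = esym j M" if "j \<le> CARD('n)" for j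
  proof -
    have "coeff p (CARD('n) - j) = (\<Sum>k\<le>CARD('n). if k = j then esym j M else 0)"
      unfolding p_def coeff_sum coeff_monom using that by (intro sum.cong) auto
    then show ?thesis using that by simp
  qed
  have "{I :: 'n set. card I = 0} = {{}}" by auto
  then have "coeff p CARD('n) = 1"
    using co[of 0] by (simp add: esym_def sign_id)
  then have "CARD('n) \<le> degree p" by (intro le_degree) simp
  then have "coeff p (CARD('n) - k) \<noteq> 0"
    using half_plane_coeff_nonzero[of \<zeta> p "CARD('n) - k"] det_scalar_add_nonzero[OF assms(1)] ev
    by fastforce
  then show ?thesis using co[OF assms(2)] by simp
qed

text \<open>Hence the form of a symmetric matrix is real and that of a skew matrix is imaginary.\<close>

lemma qform_cmat:
  fixes R :: "real ^ 'n ^ 'n"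
  defines "x \<equiv> \<lambda>v :: complex ^ 'n. (\<chi> i. Re (v $ i))" and "y \<equiv> \<lambda>v :: complex ^ 'n. (\<chi> i. Im (v $ i))"
  shows Re_qform_cmat: "Re (qform (cmat R) v) = x v \<bullet> (R *v x v) + y v \<bullet> (R *v y v)"
    and Im_qform_cmat: "Im (qform (cmat R) v) = x v \<bullet> (R *v y v) - y v \<bullet> (R *v x v)"
proof -
  have bil: "u \<bullet> (R *v w) = (\<Sum>i\<in>UNIV. \<Sum>j\<in>UNIV. u $ i * R $ i $ j * w $ j)" for u w
    by (simp add: inner_vec_def matrix_vector_mult_def sum_distrib_left mult.assoc)
  have Re: "Re (cnj (v $ i) * cmat R $ i $ j * v $ j)
      = x v $ i * R $ i $ j * x v $ j + y v $ i * R $ i $ j * y v $ j" for i j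
    by (simp add: cmat_def x_def y_def)
  have Im: "Im (cnj (v $ i) * cmat R $ i $ j * v $ j)
      = x v $ i * R $ i $ j * y v $ j - y v $ i * R $ i $ j * x v $ j" for i j
    by (simp add: cmat_def x_def y_def)
  show "Re (qform (cmat R) v) = x v \<bullet> (R *v x v) + y v \<bullet> (R *v y v)"
    unfolding qform_def Re_sum Re bil by (simp only: sum.distrib)
  show "Im (qform (cmat R) v) = x v \<bullet> (R *v y v) - y v \<bullet> (R *v x v)"
    unfolding qform_def Im_sum Im bil by (simp only: sum_subtractf)
qed

abbreviation sym_pd :: "real ^ 'n ^ 'n \<Rightarrow> bool" where
  "sym_pd A \<equiv> transpose A = A \<and> pos_def A"

text \<open>Smallness of the skew matrix is measured by the form of \<open>A\<close> rather than by a norm. This is the bound on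
  the numerical range that the arguments below use, and it needs no eigenvalues.\<close>

definition rel_skew :: "real \<Rightarrow> real ^ 'n ^ 'n \<Rightarrow> real ^ 'n ^ 'n \<Rightarrow> bool" where
  "rel_skew \<theta> A X \<longleftrightarrow> transpose X = - X \<and> (\<forall>v. \<bar>Im (qform (cmat X) v)\<bar> \<le> \<theta> * Re (qform (cmat A) v))"

lemma qform_sym_pd:
  assumes "sym_pd A"
  shows "Im (qform (cmat A) v) = 0" and "v \<noteq> 0 \<Longrightarrow> 0 < Re (qform (cmat A) v)"
proof -
  let ?x = "\<chi> i. Re (v $ i)" and ?y = "\<chi> i. Im (v $ i)"
  have "?x \<bullet> (A *v ?y) = ?y \<bullet> (A *v ?x)"
    using assms by (metis dot_lmul_matrix inner_commute transpose_matrix_vector)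
  then show "Im (qform (cmat A) v) = 0" by (simp add: Im_qform_cmat)
  assume "v \<noteq> 0"
  then have "?x \<noteq> 0 \<or> ?y \<noteq> 0" by (auto simp: vec_eq_iff complex_eq_iff)
  moreover have "0 \<le> w \<bullet> (A *v w)" for w using assms by (cases "w = 0") (auto simp: pos_def_def less_imp_le)
  moreover have "w \<noteq> 0 \<Longrightarrow> 0 < w \<bullet> (A *v w)" for w using assms by (auto simp: pos_def_def)
  ultimately show "0 < Re (qform (cmat A) v)"
    unfolding Re_qform_cmat by (metis add_nonneg_pos add_pos_nonneg)
qed

lemma Re_qform_skew:
  assumes "transpose X = - X"
  shows "Re (qform (cmat X) v) = 0"
proof -
  have "w \<bullet> (X *v w) = 0" for w
  proof -
    have "w \<bullet> (X *v w) = (transpose X *v w) \<bullet> w"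
      by (simp add: dot_lmul_matrix)
    also have "\<dots> = - (w \<bullet> (X *v w))"
      by (simp add: assms inner_commute matrix_vector_mult_def inner_vec_def sum_negf)
    finally show ?thesis by simp
  qed
  then show ?thesis by (simp add: Re_qform_cmat)
qed

text \<open>With \<open>v = x + i y\<close> the form of a skew \<open>X\<close> is \<open>2 i x \<bullet> X y\<close>, which is at most \<open>m (\<bar>x\<bar>\<^sup>2 + \<bar>y\<bar>\<^sup>2)\<close> in
  modulus.\<close>

lemma rel_skewI:
  fixes A X :: "real ^ 'n ^ 'n"
  assumes "transpose X = - X" and "\<And>x. l * (norm x)\<^sup>2 \<le> x \<bullet> (A *v x)"
    and "\<And>x. norm (X *v x) \<le> m * norm x" and "m \<le> \<theta> * l" and "0 \<le> \<theta>" and "0 \<le> m"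
  shows "rel_skew \<theta> A X"
  unfolding rel_skew_def
proof (intro conjI allI assms(1))
  fix v :: "complex ^ 'n"
  let ?x = "\<chi> i. Re (v $ i)" and ?y = "\<chi> i. Im (v $ i)"
  have b: "\<bar>x \<bullet> (X *v y)\<bar> \<le> m * (norm x * norm y)" for x y
    using order_trans[OF Cauchy_Schwarz_ineq2 mult_left_mono[OF assms(3) norm_ge_zero]]
    by (simp add: mult.left_commute)
  have "\<bar>Im (qform (cmat X) v)\<bar> \<le> m * (2 * norm ?x * norm ?y)"
    using b[of ?x ?y] b[of ?y ?x] by (simp add: Im_qform_cmat algebra_simps)
  also have "\<dots> \<le> m * ((norm ?x)\<^sup>2 + (norm ?y)\<^sup>2)"
    by (intro mult_left_mono sum_squares_bound assms)
  also have "\<dots> \<le> \<theta> * l * ((norm ?x)\<^sup>2 + (norm ?y)\<^sup>2)"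
    by (intro mult_right_mono assms) simp
  also have "\<dots> \<le> \<theta> * Re (qform (cmat A) v)"
    using mult_left_mono[OF add_mono[OF assms(2)[of ?x] assms(2)[of ?y]] assms(5)]
    by (simp add: Re_qform_cmat algebra_simps)
  finally show "\<bar>Im (qform (cmat X) v)\<bar> \<le> \<theta> * Re (qform (cmat A) v)" .
qed

lemma rel_skew_add_scale:
  fixes A X Y :: "real ^ 'n ^ 'n"
  assumes "rel_skew \<theta> A X" and "rel_skew \<theta> A Y" and "0 \<le> t"
  shows "rel_skew ((1 + t) * \<theta>) A (X + t *\<^sub>R Y)"
  unfolding rel_skew_def
proof (intro conjI allI)
  have "transpose (X + t *\<^sub>R Y) = transpose X + t *\<^sub>R transpose Y"
    by (simp add: transpose_def vec_eq_iff)
  then show "transpose (X + t *\<^sub>R Y) = - (X + t *\<^sub>R Y)"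
    using assms(1,2) by (simp add: rel_skew_def)
  fix v
  have "qform (cmat (X + t *\<^sub>R Y)) v = qform (cmat X) v + of_real t * qform (cmat Y) v"
    by (simp only: mline_real[symmetric] cmat_mline[symmetric] qform_mline)
  then have "\<bar>Im (qform (cmat (X + t *\<^sub>R Y)) v)\<bar> \<le> \<bar>Im (qform (cmat X) v)\<bar> + t * \<bar>Im (qform (cmat Y) v)\<bar>"
    using assms(3) by (simp add: abs_mult order_trans[OF abs_triangle_ineq])
  also have "\<dots> \<le> \<theta> * Re (qform (cmat A) v) + t * (\<theta> * Re (qform (cmat A) v))"
    using assms by (intro add_mono mult_left_mono) (auto simp: rel_skew_def)
  finally show "\<bar>Im (qform (cmat (X + t *\<^sub>R Y)) v)\<bar> \<le> (1 + t) * \<theta> * Re (qform (cmat A) v)"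
    by (simp add: algebra_simps)
qed

lemma sectorial_mline_pd:
  assumes "sectorial \<zeta> M" and "sym_pd B" and "0 \<le> Re (\<zeta> * u)"
  shows "sectorial \<zeta> (mline M u (cmat B))"
  unfolding sectorial_def
proof (intro allI impI)
  fix v :: "complex ^ 'a"
  assume v: "v \<noteq> 0"
  have "qform (cmat B) v = of_real (Re (qform (cmat B) v))"
    using qform_sym_pd(1)[OF assms(2), of v] by (simp add: complex_eq_iff)
  then have "Re (\<zeta> * (u * qform (cmat B) v)) = Re (\<zeta> * u) * Re (qform (cmat B) v)"
    by (metis Re_mult_of_real mult.assoc)
  then have "0 \<le> Re (\<zeta> * (u * qform (cmat B) v))"
    using qform_sym_pd(2)[OF assms(2) v] assms(3) by simp
  moreover have "0 < Re (\<zeta> * qform M v)" using assms(1) v by (simp add: sectorial_def)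
  ultimately show "0 < Re (\<zeta> * qform (mline M u (cmat B)) v)"
    by (simp only: qform_mline distrib_left plus_complex.sel)
qed

text \<open>For a vector \<open>v\<close> the form takes the value \<open>a + t (i y)\<close> with real \<open>a > 0\<close> and real \<open>y\<close>. Multiplication by
  \<open>1 - i Im t / Re t\<close> gives it the real part \<open>a\<close>. For imaginary \<open>t\<close> the division by zero makes the factor
  \<open>1\<close>, and the value is real and positive because \<open>\<bar>t y\<bar> \<le> \<bar>t\<bar> \<theta> a < a\<close>.\<close>

lemma sectorial_mline_skew:
  assumes A: "sym_pd A" and X: "rel_skew \<theta> A X" and t: "Re t \<noteq> 0 \<or> cmod t * \<theta> < 1"
  shows "sectorial (1 - \<i> * of_real (Im t / Re t)) (mline (cmat A) t (cmat X))"
  unfolding sectorial_def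
proof (intro allI impI)
  fix v :: "complex ^ 'a"
  assume v: "v \<noteq> 0"
  define a where "a = Re (qform (cmat A) v)"
  define y where "y = Im (qform (cmat X) v)"
  have a: "0 < a" using qform_sym_pd(2)[OF A v] by (simp add: a_def)
  have qA: "qform (cmat A) v = of_real a"
    using qform_sym_pd(1)[OF A] by (simp add: a_def complex_eq_iff)
  have qX: "qform (cmat X) v = \<i> * of_real y"
    using Re_qform_skew[of X v] X by (simp add: y_def complex_eq_iff rel_skew_def)
  have yb: "\<bar>y\<bar> \<le> \<theta> * a" using X by (simp add: rel_skew_def a_def y_def)
  have Re: "Re ((1 - \<i> * of_real (Im t / Re t)) * qform (mline (cmat A) t (cmat X)) v)
      = a - Im t * y + Im t / Re t * (Re t * y)"
    by (simp add: qform_mline qA qX)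
  show "0 < Re ((1 - \<i> * of_real (Im t / Re t)) * qform (mline (cmat A) t (cmat X)) v)"
  proof (cases "Re t = 0")
    case True
    have "Im t * y \<le> cmod t * (\<theta> * a)"
      using mult_mono[OF abs_Im_le_cmod yb, of t] by (simp add: abs_le_iff abs_mult[symmetric])
    also have "\<dots> < 1 * a" unfolding mult.assoc[symmetric]
      using t True a by (intro mult_strict_right_mono) auto
    finally show ?thesis unfolding Re using True by simp
  next
    case False
    then show ?thesis unfolding Re using a by simp
  qed
qed

text \<open>The numerical range lies in the convex cone spanned by \<open>1\<close> and \<open>t\<close>. Unless \<open>t\<close> is on the negative
  axis, the bisector \<open>1 + t / \<bar>t\<bar>\<close> of that cone is not zero, and its conjugate turns the cone into the right
  half-plane.\<close>

lemma sectorial_mline_pd_pd: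
  assumes A: "sym_pd A" and B: "sym_pd B" and t: "\<not> (Im t = 0 \<and> Re t \<le> 0)"
  shows "\<exists>\<zeta>. sectorial \<zeta> (mline (cmat A) t (cmat B))"
proof
  have t0: "t \<noteq> 0" using t by auto
  let ?\<zeta> = "1 + cnj t / cmod t"
  have gt: "- cmod t < Re t"
  proof (rule ccontr)
    assume "\<not> - cmod t < Re t"
    then have eq: "Re t = - cmod t" using abs_Re_le_cmod[of t] by linarith
    then have "Im t = 0" using cmod_power2[of t] by simp
    then show False using t eq by simp
  qed
  have "cmod t * Re ?\<zeta> = cmod t + Re t" using t0 by (simp add: field_simps)
  then have r1: "0 < Re ?\<zeta>" using gt t0
    by (smt (verit) mult_nonneg_nonpos2 mult.commute norm_ge_zero)
  have "?\<zeta> * t = t + of_real (cmod t)"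
    using t0 by (simp add: field_simps complex_norm_square[symmetric] power2_eq_square)
  then have r2: "0 \<le> Re (?\<zeta> * t)" using gt by simp
  have "sectorial ?\<zeta> (cmat A)"
    unfolding sectorial_def
  proof (intro allI impI)
    fix v :: "complex ^ 'a"
    assume v: "v \<noteq> 0"
    then show "0 < Re (?\<zeta> * qform (cmat A) v)"
      using qform_sym_pd[OF A, of v] r1 by simp
  qed
  then show "sectorial ?\<zeta> (mline (cmat A) t (cmat B))"
    using B r2 by (rule sectorial_mline_pd)
qed

section \<open>Inequalities from the location of zeros\<close>

text \<open>On the ray \<open>A + X + x I\<close>, \<open>x \<ge> 0\<close>, the form has positive real part, so the sum of minors does not vanish
  there. It is positive for large \<open>x\<close>, hence also at \<open>x = 0\<close>.\<close>

lemma esym_pd_skew_pos: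
  fixes A X :: "real ^ 'n ^ 'n"
  assumes A: "sym_pd A" and X: "rel_skew \<theta> A X" and k: "k \<le> CARD('n)"
  shows "0 < esym k (A + X)"
proof -
  let ?p = "line_poly k (A + X) (mat 1)"
  have pd1: "sym_pd (mat 1 :: real ^ 'n ^ 'n)"
    by (simp add: transpose_mat pos_def_def)
  have sec: "sectorial 1 (cmat (A + X))"
    using sectorial_mline_skew[OF A X, of 1] cmat_mline[of A 1 X] mline_real[of A 1 X] by simp
  have top: "coeff ?p k = real (CARD('n) choose k)"
    by (simp add: coeff_line_poly_top esym_mat_1)
  then have "coeff ?p k \<noteq> 0" using k by simp
  then have "degree ?p = k" using degree_line_poly[of k "A + X" "mat 1"] le_degree by (metis le_antisym)
  then have lc: "0 < lead_coeff ?p" using top k by simp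
  have "poly ?p x \<noteq> 0" if x: "0 \<le> x" for x
  proof -
    have "sectorial 1 (cmat (mline (A + X) x (mat 1)))"
      unfolding cmat_mline[symmetric] using sec pd1 x by (intro sectorial_mline_pd) auto
    then have "esym k (cmat (mline (A + X) x (mat 1))) \<noteq> 0" using k by (rule esym_nonzero)
    then show ?thesis by (simp add: esym_cmat poly_line_poly)
  qed
  then have "0 < poly ?p 0" by (rule real_poly_pos_at_0[OF lc])
  then show ?thesis by (simp add: poly_0_coeff_0 coeff_line_poly_0)
qed

lemma rel_skew_zero: "rel_skew 0 A 0"
  by (simp add: rel_skew_def qform_def cmat_def transpose_def vec_eq_iff)

lemma esym_pd_pos:
  fixes A :: "real ^ 'n ^ 'n"
  assumes "sym_pd A" and "k \<le> CARD('n)"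
  shows "0 < esym k A"
  using esym_pd_skew_pos[OF assms(1) rel_skew_zero assms(2)] by simp

lemma degree_line_poly_pd:
  fixes B :: "real ^ 'n ^ 'n"
  assumes "sym_pd B" and "k \<le> CARD('n)"
  shows "degree (line_poly k M (cmat B)) = k"
proof -
  have "coeff (line_poly k M (cmat B)) k \<noteq> 0"
    using esym_pd_pos[OF assms] by (simp add: coeff_line_poly_top esym_cmat)
  then show ?thesis using degree_line_poly[of k M "cmat B"] le_degree by (metis le_antisym)
qed

text \<open>The quotient \<open>desym k (A + X) B / esym k (A + X)\<close> is the logarithmic derivative at \<open>u = 0\<close> of
  \<open>u \<mapsto> esym k (A + X + u B)\<close>, which has no zero with \<open>0 \<le> Re u\<close>.\<close>

lemma desym_pd_skew_pos:
  fixes A B X :: "real ^ 'n ^ 'n"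
  assumes A: "sym_pd A" and X: "rel_skew \<theta> A X" and B: "sym_pd B" and k: "0 < k" "k \<le> CARD('n)"
  shows "0 < desym k (A + X) B"
proof -
  let ?p = "line_poly k (cmat (A + X)) (cmat B)"
  have sec: "sectorial 1 (cmat (A + X))"
    using sectorial_mline_skew[OF A X, of 1] cmat_mline[of A 1 X] mline_real[of A 1 X] by simp
  have "poly ?p u \<noteq> 0" if "0 \<le> Re (1 * u)" for u
    unfolding poly_line_poly using sectorial_mline_pd[OF sec B that] k(2) by (rule esym_nonzero)
  then have "0 < Re (cnj 1 * (poly (pderiv ?p) 0 / poly ?p 0))"
    by (rule half_plane_log_deriv_pos) (use degree_line_poly_pd[OF B k(2)] k(1) in auto)
  moreover have "poly (pderiv ?p) 0 = of_real (desym k (A + X) B)"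
    using coeff_line_poly_1[of k "cmat (A + X)" "cmat B"]
    by (simp add: poly_0_coeff_0 coeff_pderiv desym_cmat)
  moreover have "poly ?p 0 = of_real (esym k (A + X))"
    by (simp add: poly_0_coeff_0 coeff_line_poly_0 esym_cmat)
  ultimately have "0 < desym k (A + X) B / esym k (A + X)"
    by (simp flip: of_real_divide)
  then show ?thesis using esym_pd_skew_pos[OF A X k(2)] by (simp add: zero_less_divide_iff)
qed

text \<open>For \<open>c = 1\<close> this is concavity of \<open>ln (esym k)\<close>, because \<open>desym k A (B - A) / esym k A\<close> is
  \<open>desym k A B / esym k A - k\<close>. The freedom in \<open>c\<close> comes from the homogeneity and amounts to replacing \<open>B\<close> by
  \<open>c B\<close>.\<close>

lemma ln_esym_le_tangent:
  fixes A B :: "real ^ 'n ^ 'n"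
  assumes A: "sym_pd A" and B: "sym_pd B" and k: "k \<le> CARD('n)" and c: "0 < c"
  shows "ln (esym k B) - ln (esym k A) \<le> c * (desym k A B / esym k A) - k - k * ln c"
proof -
  let ?p = "line_poly k (cmat A) (cmat B)"
  have SA: "0 < esym k A" and SB: "0 < esym k B" using esym_pd_pos A B k by blast+
  have p0: "poly ?p 0 = of_real (esym k A)"
    by (simp add: poly_0_coeff_0 coeff_line_poly_0 esym_cmat)
  then have "poly ?p 0 \<noteq> 0" using SA by simp
  then obtain d where d: "\<And>z. poly ?p z = poly ?p 0 * (\<Prod>i<degree ?p. 1 + d i * z)"
    and root: "\<And>i. i < degree ?p \<Longrightarrow> d i \<noteq> 0 \<and> poly ?p (- 1 / d i) = 0"
    using poly_eq_prod_reciprocal_roots by metis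
  have deg: "degree ?p = k" using B k by (rule degree_line_poly_pd)
  define a where "a i = Re (d i)" for i
  have a: "d i = of_real (a i) \<and> 0 < a i" if i: "i < k" for i
  proof -
    let ?t = "- 1 / d i"
    have "esym k (mline (cmat A) ?t (cmat B)) = 0"
      unfolding poly_line_poly[symmetric] using root[unfolded deg, OF i] by blast
    then have "\<not> (\<exists>\<zeta>. sectorial \<zeta> (mline (cmat A) ?t (cmat B)))"
      using esym_nonzero[OF _ k] by blast
    then have t: "Im ?t = 0" "Re ?t \<le> 0" using sectorial_mline_pd_pd[OF A B, of ?t] by blast+
    have "?t = of_real (Re ?t)" using t by (simp add: complex_eq_iff)
    moreover have "d i = - 1 / ?t" using root[of i] i deg by simp
    ultimately have di: "d i = of_real (- 1 / Re ?t)" by (metis of_real_1 of_real_divide of_real_minus)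
    have "Re ?t \<noteq> 0" using di root[of i] i deg by (metis div_by_0 of_real_0)
    then have "0 < - 1 / Re ?t" using t(2) by (simp add: field_simps)
    then show ?thesis using di unfolding a_def by (metis Re_complex_of_real)
  qed
  have "poly ?p = poly (smult (of_real (esym k A)) (\<Prod>i<k. [:1, of_real (a i):]))"
  proof
    fix z
    have "poly ?p z = of_real (esym k A) * (\<Prod>i<k. 1 + of_real (a i) * z)"
      using d[of z] a deg p0 by simp
    then show "poly ?p z = poly (smult (of_real (esym k A)) (\<Prod>i<k. [:1, of_real (a i):])) z"
      by (simp add: poly_prod mult.commute)
  qed
  then have p: "?p = smult (of_real (esym k A)) (\<Prod>i<k. [:1, of_real (a i):])"
    by (simp only: poly_eq_poly_eq_iff)
  have "complex_of_real (esym k B) = of_real (esym k A * (\<Prod>i<k. a i))"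
    using arg_cong[OF p, of "\<lambda>p. coeff p k"] coeff_top_prod_linear[of "{..<k}" "\<lambda>_. 1" "\<lambda>i. complex_of_real (a i)"]
    by (simp add: coeff_line_poly_top esym_cmat)
  then have top: "esym k B = esym k A * (\<Prod>i<k. a i)" by (simp only: of_real_eq_iff)
  have "complex_of_real (desym k A B) = of_real (esym k A * (\<Sum>i<k. a i))"
    using arg_cong[OF p, of "\<lambda>p. coeff p 1"] coeff_1_prod_linear[of "\<lambda>_. 1" "\<lambda>i. complex_of_real (a i)" "{..<k}"]
      coeff_line_poly_1[of k "cmat A" "cmat B"]
    by (simp add: desym_cmat)
  then have one: "desym k A B = esym k A * (\<Sum>i<k. a i)" by (simp only: of_real_eq_iff)
  have "0 < (\<Prod>i<k. a i)" using a by (intro prod_pos) auto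
  then have "ln (esym k B) - ln (esym k A) = ln (\<Prod>i<k. a i)"
    unfolding top using SA by (simp add: ln_mult_pos)
  also have "\<dots> = (\<Sum>i<k. ln (a i))"
  proof (rule ln_prod)
    fix i assume "i \<in> {..<k}"
    then have "0 < a i" using a by blast
    then show "a i \<noteq> 0" by simp
  qed simp
  also have "\<dots> \<le> (\<Sum>i<k. c * a i - 1 - ln c)"
  proof (rule sum_mono)
    fix i assume "i \<in> {..<k}"
    then have "0 < a i" using a by simp
    then show "ln (a i) \<le> c * a i - 1 - ln c"
      using ln_le_minus_one[of "c * a i"] c by (simp add: ln_mult)
  qed
  also have "\<dots> = c * (desym k A B / esym k A) - k - k * ln c"
    using SA by (simp add: one sum_subtractf flip: sum_distrib_left)
  finally show ?thesis .
qed

text \<open>The zeros of \<open>t \<mapsto> esym k (A + t X)\<close> are imaginary with \<open>1 \<le> \<bar>t\<bar> \<theta>\<close>, since elsewhere the form is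
  contained in a half-plane.\<close>

lemma esym_skew_perturbation:
  fixes A X :: "real ^ 'n ^ 'n"
  assumes A: "sym_pd A" and X: "rel_skew \<theta> A X" and k: "k \<le> CARD('n)"
  shows esym_le_skew_perturbed: "esym k A \<le> esym k (A + X)"
    and esym_skew_perturbed_le: "esym k (A + X) \<le> esym k A * (1 + \<theta>\<^sup>2) ^ k"
proof -
  let ?p = "line_poly k (cmat A) (cmat X)"
  have pos: "0 < esym k A" "0 < esym k (A + X)"
    using esym_pd_pos[OF A k] esym_pd_skew_pos[OF A X k] .
  have p0: "poly ?p 0 = of_real (esym k A)"
    by (simp add: poly_0_coeff_0 coeff_line_poly_0 esym_cmat)
  have p1: "poly ?p 1 = of_real (esym k (A + X))"
    using cmat_mline[of A 1 X] mline_real[of A 1 X] esym_cmat[of k "A + X"] by (simp add: poly_line_poly)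
  have root: "Re t = 0 \<and> 1 \<le> cmod t * \<theta>" if t: "poly ?p t = 0" for t
  proof (rule ccontr)
    assume "\<not> ?thesis"
    then have "Re t \<noteq> 0 \<or> cmod t * \<theta> < 1" by auto
    then show False
      using esym_nonzero[OF sectorial_mline_skew[OF A X] k] t unfolding poly_line_poly by blast
  qed
  have nz: "poly ?p 0 \<noteq> 0" using pos p0 by simp
  show "esym k A \<le> esym k (A + X)"
    using imaginary_roots_modulus_ge[OF nz] root pos by (simp add: p0 p1)
  have "esym k (A + X) \<le> esym k A * (1 + \<theta>\<^sup>2) ^ degree ?p"
    using imaginary_roots_modulus_le[OF nz, of \<theta>] root pos by (simp add: p0 p1)
  also have "\<dots> \<le> esym k A * (1 + \<theta>\<^sup>2) ^ k"
    using pos degree_line_poly by (intro mult_left_mono power_increasing) auto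
  finally show "esym k (A + X) \<le> esym k A * (1 + \<theta>\<^sup>2) ^ k" .
qed

text \<open>As a function of \<open>u\<close>, \<open>esym k (A + t X + u B)\<close> has its zeros in a half-plane excluding \<open>0\<close> as soon as
  \<open>Re t \<noteq> 0\<close>. Then its coefficient of \<open>u\<close>, which is \<open>desym k (A + t X) B\<close>, does not vanish, and so the
  zeros of the latter in \<open>t\<close> are imaginary.\<close>

lemma desym_le_skew_perturbed:
  fixes A B X :: "real ^ 'n ^ 'n"
  assumes A: "sym_pd A" and X: "rel_skew \<theta> A X" and B: "sym_pd B" and k: "0 < k" "k \<le> CARD('n)"
  shows "desym k A B \<le> desym k (A + X) B"
proof -
  let ?p = "dline_poly k (cmat A) (cmat X) (cmat B)"
  have p0: "poly ?p 0 = of_real (desym k A B)"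
    by (simp add: poly_dline_poly desym_cmat[symmetric])
  have p1: "poly ?p 1 = of_real (desym k (A + X) B)"
    using cmat_mline[of A 1 X] mline_real[of A 1 X] desym_cmat[of k "A + X" B] by (simp add: poly_dline_poly)
  have pos: "0 < desym k A B" "0 < desym k (A + X) B"
    using desym_pd_skew_pos[OF A rel_skew_zero B k] desym_pd_skew_pos[OF A X B k] by simp_all
  have root: "Re t = 0" if t: "poly ?p t = 0" for t
  proof (rule ccontr)
    assume "Re t \<noteq> 0"
    let ?\<zeta> = "1 - \<i> * of_real (Im t / Re t)" and ?M = "mline (cmat A) t (cmat X)"
    have sec: "sectorial ?\<zeta> ?M" using \<open>Re t \<noteq> 0\<close> by (intro sectorial_mline_skew[OF A X]) simp
    have "poly (line_poly k ?M (cmat B)) u \<noteq> 0" if "0 \<le> Re (?\<zeta> * u)" for u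
      unfolding poly_line_poly using sectorial_mline_pd[OF sec B that] k(2) by (rule esym_nonzero)
    then have "coeff (line_poly k ?M (cmat B)) 1 \<noteq> 0"
      by (rule half_plane_coeff_nonzero[of ?\<zeta>]) (use degree_line_poly_pd[OF B k(2)] k(1) in auto)
    then show False using t unfolding coeff_line_poly_1 poly_dline_poly by simp
  qed
  have "poly ?p 0 \<noteq> 0" using pos p0 by simp
  then show ?thesis using imaginary_roots_modulus_ge[of ?p] root pos by (simp add: p0 p1)
qed

text \<open>The size of \<open>Y\<close> alone accounts for one order in \<open>\<theta>\<close>. The second order is gained because the
  values \<open>esym k (A + X + j Y)\<close> differ from \<open>esym k A\<close> by \<open>O(\<theta>\<^sup>2) esym k A\<close> only, and interpolation passes
  from them to the derivative.\<close>

lemma desym_skew_skew_bound: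
  fixes k :: nat
  obtains C where "0 \<le> C" and "\<And>(A :: real ^ 'n ^ 'n) X Y \<theta>. sym_pd A \<Longrightarrow> rel_skew \<theta> A X \<Longrightarrow> rel_skew \<theta> A Y \<Longrightarrow>
    \<theta>\<^sup>2 \<le> 1 \<Longrightarrow> k \<le> CARD('n) \<Longrightarrow> \<bar>desym k (A + X) Y\<bar> \<le> C * \<theta>\<^sup>2 * esym k A"
proof -
  obtain C :: real where C: "0 \<le> C"
    and bound: "\<And>p M. degree p \<le> k \<Longrightarrow> \<forall>j\<le>k. \<bar>poly p (real j)\<bar> \<le> M \<Longrightarrow> \<bar>coeff p 1\<bar> \<le> C * M"
    using coeff_1_bound_by_node_values[of k] by blast
  \<comment> \<open>the perturbation \<open>X + j Y\<close> with \<open>j \<le> k\<close> is small with constant \<open>(1 + k) \<theta>\<close>\<close>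
  define K where "K = (1 + (1 + real k)\<^sup>2) ^ k"
  have "\<bar>desym k (A + X) Y\<bar> \<le> C * K * \<theta>\<^sup>2 * esym k A"
    if A: "sym_pd A" and X: "rel_skew \<theta> A X" and Y: "rel_skew \<theta> A Y" and \<theta>: "\<theta>\<^sup>2 \<le> 1" and k: "k \<le> CARD('n)"
    for A X Y :: "real ^ 'n ^ 'n" and \<theta>
  proof -
    have SA: "0 < esym k A" using A k by (rule esym_pd_pos)
    let ?p = "line_poly k (A + X) Y - [:esym k A:]"
    have "\<bar>coeff ?p 1\<bar> \<le> C * (esym k A * (\<theta>\<^sup>2 * K))"
    proof (rule bound, safe)
      show "degree ?p \<le> k" using degree_line_poly by (intro degree_diff_le) auto
    next
      fix j assume j: "j \<le> k"
      let ?Z = "X + real j *\<^sub>R Y"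
      have Z: "rel_skew ((1 + real j) * \<theta>) A ?Z" using X Y by (rule rel_skew_add_scale) simp
      have val: "poly ?p (real j) = esym k (A + ?Z) - esym k A"
        by (simp only: poly_diff poly_line_poly mline_real add.assoc) simp
      have "esym k (A + ?Z) \<le> esym k A * (1 + ((1 + real j) * \<theta>)\<^sup>2) ^ k"
        using A Z k by (rule esym_skew_perturbed_le)
      also have "\<dots> \<le> esym k A * (1 + (1 + real k)\<^sup>2 * \<theta>\<^sup>2) ^ k"
        unfolding power_mult_distrib using SA j
        by (intro mult_left_mono power_mono add_left_mono mult_right_mono) auto
      also have "\<dots> \<le> esym k A * (1 + \<theta>\<^sup>2 * K)"
      proof (rule mult_left_mono)
        have "(1 + (1 + real k)\<^sup>2 * \<theta>\<^sup>2) ^ k \<le> 1 + \<theta>\<^sup>2 * (K - 1)"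
          unfolding K_def using \<theta> by (intro power_one_plus_scaled_le) auto
        also have "\<dots> \<le> 1 + \<theta>\<^sup>2 * K" by (simp add: mult_left_mono)
        finally show "(1 + (1 + real k)\<^sup>2 * \<theta>\<^sup>2) ^ k \<le> 1 + \<theta>\<^sup>2 * K" .
      qed (use SA in simp)
      finally show "\<bar>poly ?p (real j)\<bar> \<le> esym k A * (\<theta>\<^sup>2 * K)"
        unfolding val using esym_le_skew_perturbed[OF A Z k] by (simp add: algebra_simps)
    qed
    then show ?thesis using coeff_line_poly_1[of k "A + X" Y] by (simp add: mult_ac)
  qed
  moreover have "0 \<le> C * K" using C by (simp add: K_def)
  ultimately show thesis using that by blast
qed

section \<open>From eigenvalues to principal minors\<close>

lemma poly_map_poly_of_real_charpoly:
  fixes R :: "real ^ 'n ^ 'n"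
  shows "poly (map_poly complex_of_real (charpoly R)) z = det (\<chi> i j. (if i = j then z else 0) - cmat R $ i $ j)"
proof -
  let ?h = "\<lambda>p. poly (map_poly complex_of_real p) z"
  have h_add: "?h (p + q) = ?h p + ?h q" for p q
  proof -
    have "map_poly complex_of_real (p + q) = map_poly of_real p + map_poly of_real q"
      by (rule poly_eqI) (simp add: coeff_map_poly)
    then show ?thesis by simp
  qed
  have h_mult: "?h (p * q) = ?h p * ?h q" for p q
  proof -
    have "map_poly complex_of_real (p * q) = map_poly of_real p * map_poly of_real q"
      by (rule poly_eqI) (simp add: coeff_map_poly coeff_mult)
    then show ?thesis by simp
  qed
  have h_sum: "?h (sum f S) = (\<Sum>x\<in>S. ?h (f x))" for f :: "'b \<Rightarrow> real poly" and S
    by (induction S rule: infinite_finite_induct) (simp_all add: h_add)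
  have h_prod: "?h (prod f S) = (\<Prod>x\<in>S. ?h (f x))" for f :: "'b \<Rightarrow> real poly" and S
    by (induction S rule: infinite_finite_induct) (simp_all add: h_mult)
  have h_sign: "?h (of_int m) = of_int m" for m
    by (simp add: of_int_poly map_poly_pCons)
  have h_entry: "?h ((if i = j then [:0, 1:] else 0) - [:r:]) = (if i = j then z else 0) - of_real r" for i j :: 'n and r
    by (simp add: map_poly_pCons)
  show ?thesis
    by (simp add: charpoly_def det_def h_sum h_mult h_prod h_sign h_entry cmat_def del: diff_pCons)
qed

text \<open>Both are the coefficients of \<open>s ^ (n - k)\<close> in \<open>det (s I + R) = \<Prod>(s + l\<^sub>i)\<close>.\<close>

lemma S_k_eq_esym:
  fixes R :: "real ^ 'n ^ 'n"
  assumes k: "k \<le> CARD('n)"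
  shows "S_k k R = esym k R"
proof -
  define l where "l = eigenvalues R"
  have l: "map_poly complex_of_real (charpoly R) = (\<Prod>i\<in>UNIV. [:- (l $ i), 1:])"
    using is_eigenvalue_vector_eigenvalues[of R] by (simp add: is_eigenvalue_vector_def l_def)
  have char: "(\<Prod>i\<in>UNIV. s + l $ i) = det (\<chi> i j. (if i = j then s else 0) + cmat R $ i $ j)" for s
  proof -
    have "(- 1) ^ CARD('n) * (\<Prod>i\<in>UNIV. s + l $ i) = (\<Prod>i\<in>UNIV. - (s + l $ i))"
      by (simp only: prod_uminus)
    also have "\<dots> = poly (map_poly complex_of_real (charpoly R)) (- s)"
      by (simp add: l poly_prod algebra_simps)
    also have "\<dots> = det (\<chi> i j. (if i = j then - s else 0) - cmat R $ i $ j)"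
      by (rule poly_map_poly_of_real_charpoly)
    also have "\<dots> = det (\<chi> i j. - ((if i = j then s else 0) + cmat R $ i $ j))"
      by (rule arg_cong[of _ _ det]) (auto simp: vec_eq_iff)
    also have "\<dots> = (- 1) ^ CARD('n) * det (\<chi> i j. (if i = j then s else 0) + cmat R $ i $ j)"
      unfolding det_def vec_lambda_beta prod_uminus sum_distrib_left by (simp only: mult.left_commute)
    finally show ?thesis by simp
  qed
  have expand: "(\<Prod>i\<in>UNIV. s + l $ i) = (\<Sum>k\<le>CARD('n). sigma k l * s ^ (CARD('n) - k))" for s
  proof -
    have "(\<Prod>i\<in>UNIV. s + l $ i) = (\<Sum>I\<in>UNIV. (\<Prod>i\<in>I. l $ i) * s ^ (CARD('n) - card I))"
      using prod_add[of "UNIV :: 'n set" "\<lambda>i. l $ i" "\<lambda>_. s"] by (simp add: add.commute card_Diff_subset)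
    also have "\<dots> = (\<Sum>k\<le>CARD('n). \<Sum>I | I \<in> UNIV \<and> card I = k. (\<Prod>i\<in>I. l $ i) * s ^ (CARD('n) - card I))"
      by (rule sum.group[symmetric]) (auto intro: card_mono)
    also have "\<dots> = (\<Sum>k\<le>CARD('n). sigma k l * s ^ (CARD('n) - k))"
      by (simp add: sigma_def sum_distrib_right)
    finally show ?thesis .
  qed
  have "(\<Sum>k\<le>CARD('n). sigma k l * s ^ (CARD('n) - k)) = (\<Sum>k\<le>CARD('n). esym k (cmat R) * s ^ (CARD('n) - k))" for s
    using char[of s] expand[of s] det_scalar_add_eq_sum_esym[of s "cmat R"] by simp
  then have "sigma k l = esym k (cmat R)" using k by (rule coeff_eq_of_power_sums)
  then show ?thesis by (simp add: S_k_def esym_cmat flip: l_def)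
qed

text \<open>The minimum \<open>m\<close> of the form on the unit sphere is attained at an eigenvector \<open>u\<close>, so \<open>m\<close> occurs among the
  chosen eigenvalues and is at least the smallest of them. That \<open>u\<close> is an eigenvector follows from first-order
  optimality: \<open>x \<bullet> A x - m \<bar>x\<bar>\<^sup>2\<close> is nonnegative and vanishes at \<open>u\<close>, so its derivative at \<open>u\<close> in the
  direction \<open>w = A u - m u\<close>, which is \<open>2 w \<bullet> w\<close>, is zero.\<close>

lemma lambda_min_le_quadratic_form:
  fixes A :: "real ^ 'n ^ 'n"
  assumes sym: "transpose A = A"
  shows "lambda_min A * (norm x)\<^sup>2 \<le> x \<bullet> (A *v x)"
proof -
  have "continuous_on (sphere 0 1) (\<lambda>x. x \<bullet> (A *v x))"
    by (intro continuous_intros matrix_vector_mult_linear_continuous_on)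
  moreover have "sphere (0 :: real ^ 'n) 1 \<noteq> {}" by simp
  ultimately obtain u where "u \<in> sphere 0 1" and "\<forall>x\<in>sphere 0 1. u \<bullet> (A *v u) \<le> x \<bullet> (A *v x)"
    using continuous_attains_inf[OF compact_sphere] by blast
  then have u: "norm u = 1" and umin: "\<And>x. norm x = 1 \<Longrightarrow> u \<bullet> (A *v u) \<le> x \<bullet> (A *v x)"
    by auto
  define m where "m = u \<bullet> (A *v u)"
  have quad: "m * (norm x)\<^sup>2 \<le> x \<bullet> (A *v x)" for x
  proof (cases "x = 0")
    case False
    let ?y = "x /\<^sub>R norm x"
    have "m \<le> ?y \<bullet> (A *v ?y)" unfolding m_def by (rule umin) (use False in simp)
    also have "\<dots> = (x \<bullet> (A *v x)) / (norm x)\<^sup>2"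
      by (simp add: matrix_vector_mult_scaleR power2_eq_square divide_inverse)
    finally show ?thesis using False by (simp add: pos_le_divide_eq)
  qed simp
  define w where "w = A *v u - m *\<^sub>R u"
  have "w = 0"
  proof (rule ccontr)
    assume "w \<noteq> 0"
    define g where "g = w \<bullet> (A *v w) - m * (norm w)\<^sup>2"
    have g: "0 \<le> g" using quad[of w] by (simp add: g_def)
    have symA: "w \<bullet> (A *v u) = u \<bullet> (A *v w)"
      using sym by (metis dot_lmul_matrix inner_commute transpose_matrix_vector)
    have ww: "w \<bullet> w = u \<bullet> (A *v w) - m * (w \<bullet> u)"
      by (simp add: w_def[symmetric] symA[symmetric] inner_diff_right[symmetric] flip: inner_scaleR_right)
    have uu: "u \<bullet> u = 1" using u by (simp add: dot_square_norm)
    have key: "0 \<le> 2 * t * (w \<bullet> w) + t\<^sup>2 * g" for t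
    proof -
      have "m * ((u + t *\<^sub>R w) \<bullet> (u + t *\<^sub>R w)) \<le> (u + t *\<^sub>R w) \<bullet> (A *v (u + t *\<^sub>R w))"
        using quad[of "u + t *\<^sub>R w"] by (simp only: dot_square_norm)
      moreover have "2 * t * (w \<bullet> w) = 2 * t * (u \<bullet> (A *v w)) - 2 * t * m * (w \<bullet> u)"
        by (subst ww) (simp add: algebra_simps)
      moreover have "t\<^sup>2 * g = t\<^sup>2 * (w \<bullet> (A *v w)) - m * t\<^sup>2 * (w \<bullet> w)"
        unfolding g_def dot_square_norm by (simp add: algebra_simps)
      ultimately show ?thesis
        using symA uu
        by (simp add: matrix_vector_right_distrib matrix_vector_mult_scaleR inner_add_left inner_add_right
            inner_commute[of u w] power2_eq_square algebra_simps flip: m_def)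
    qed
    define a where "a = w \<bullet> w"
    have a: "0 < a" using \<open>w \<noteq> 0\<close> by (simp add: a_def)
    \<comment> \<open>the minimiser of the quadratic in \<open>key\<close> is \<open>- a / g\<close>; enlarging the denominator avoids \<open>g = 0\<close>\<close>
    define r where "r = a / (g + 1)"
    have r: "0 < r" "r * g = a - r" using a g by (simp_all add: r_def field_simps)
    have "0 \<le> r * (r * g - 2 * a)"
      using key[of "- r"] by (simp add: a_def power2_eq_square algebra_simps)
    also have "\<dots> = - (r * (a + r))" unfolding r(2) by (simp add: algebra_simps)
    also have "\<dots> < 0" using a r(1) by simp
    finally show False by simp
  qed
  have "det (\<chi> i j. (if i = j then complex_of_real m else 0) - cmat A $ i $ j) = 0"
  proof -
    let ?N = "\<chi> i j. (if i = j then complex_of_real m else 0) - cmat A $ i $ j"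
    define v where "v = (\<chi> i. complex_of_real (u $ i))"
    have "(\<Sum>j\<in>UNIV. A $ i $ j * u $ j) = m * u $ i" for i
      using arg_cong[OF \<open>w = 0\<close>, of "\<lambda>w. w $ i"] by (simp add: w_def matrix_vector_mult_def)
    then have Au: "(\<Sum>j\<in>UNIV. complex_of_real (A $ i $ j) * of_real (u $ j)) = of_real m * of_real (u $ i)" for i
      by (metis (mono_tags, lifting) of_real_mult of_real_sum sum.cong)
    have "(?N *v v) $ i = 0" for i
    proof -
      have "(?N *v v) $ i = (\<Sum>j\<in>UNIV. if j = i then of_real m * of_real (u $ i) else 0)
          - (\<Sum>j\<in>UNIV. complex_of_real (A $ i $ j) * of_real (u $ j))"
        unfolding matrix_vector_mult_def vec_lambda_beta sum_subtractf[symmetric]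
        by (intro sum.cong) (auto simp: v_def cmat_def left_diff_distrib)
      then show ?thesis by (simp add: Au)
    qed
    then have "?N *v v = 0" by (simp add: vec_eq_iff)
    moreover have "v \<noteq> 0" proof
      assume "v = 0"
      then have "u = 0" by (simp add: v_def vec_eq_iff)
      then show False using u by simp
    qed
    ultimately have "\<not> invertible ?N"
      unfolding invertible_left_inverse matrix_left_invertible_ker by blast
    then show ?thesis by (simp add: invertible_det_nz)
  qed
  then have "(\<Prod>i\<in>UNIV. complex_of_real m - eigenvalues A $ i) = 0"
    using is_eigenvalue_vector_eigenvalues[of A] poly_map_poly_of_real_charpoly[of A "of_real m"]
    by (simp add: is_eigenvalue_vector_def poly_prod)
  then obtain i where "eigenvalues A $ i = of_real m" by auto
  then have "real_eigenvalues A $ i = m" by (simp add: real_eigenvalues_def)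
  then have "lambda_min A \<le> m" unfolding lambda_min_def by (intro Min_le) auto
  then show ?thesis using quad[of x] by (meson mult_right_mono order_trans zero_le_power2)
qed

text \<open>Replacing the entry \<open>(i,j)\<close> by \<open>t\<close> moves along a line in the direction of the matrix unit, so the partial
  derivative is read off from a line polynomial; the derivative is linear in the direction.\<close>

lemma sum_entry_deriv_F_k:
  fixes R V :: "real ^ 'n ^ 'n"
  assumes k: "k \<le> CARD('n)" and pos: "0 < esym k R"
  shows "(\<Sum>i\<in>UNIV. \<Sum>j\<in>UNIV. entry_deriv (F_k k) i j R * V $ i $ j) = desym k R V / esym k R"
proof -
  let ?E = "\<lambda>i j. \<chi> p q. if p = i \<and> q = j then 1 else (0 :: real)"
  have "entry_deriv (F_k k) i j R = desym k R (?E i j) / esym k R" for i j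
  proof -
    let ?p = "line_poly k R (?E i j)"
    have "(\<chi> p q. if p = i \<and> q = j then t else R $ p $ q) = mline R (t - R $ i $ j) (?E i j)" for t
      by (auto simp: vec_eq_iff)
    then have F: "F_k k (\<chi> p q. if p = i \<and> q = j then t else R $ p $ q) = ln (poly ?p (t - R $ i $ j))" for t
      by (simp add: F_k_def S_k_eq_esym[OF k] poly_line_poly)
    have p0: "poly ?p 0 = esym k R" by (simp add: poly_0_coeff_0 coeff_line_poly_0)
    have p1: "poly (pderiv ?p) 0 = desym k R (?E i j)"
      using coeff_line_poly_1[of k R "?E i j"] by (simp add: poly_0_coeff_0 coeff_pderiv)
    have "((\<lambda>t. ln (poly ?p (t - R $ i $ j))) has_real_derivative desym k R (?E i j) / esym k R) (at (R $ i $ j))"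
      using pos by (auto intro!: derivative_eq_intros simp: p0 p1)
    then show ?thesis unfolding entry_deriv_def F by (rule DERIV_imp_deriv)
  qed
  then show ?thesis
    by (simp add: desym_eq_sum_entries[of k R V] sum_divide_distrib)
qed

section \<open>Concavity up to a second order error\<close>

text \<open>With \<open>q = (1 + \<delta>\<^sup>2)\<^sup>k\<close> the positive definite direction satisfies
  \<open>desym k A B / (q * esym k A) \<le> desym k (A + X) B / esym k (A + X)\<close>, whatever the size of \<open>B\<close>. Therefore the
  concavity inequality is used with \<open>c = 1 / q\<close>.\<close>

lemma ln_esym_d_concave:
  fixes k :: nat
  obtains C where "0 \<le> C" and
    "\<And>(A :: real ^ 'n ^ 'n) X B Y \<delta>. sym_pd A \<Longrightarrow> sym_pd B \<Longrightarrow> rel_skew \<delta> A X \<Longrightarrow> rel_skew \<delta> A Y \<Longrightarrow> rel_skew \<delta> B Y \<Longrightarrow>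
      \<delta>\<^sup>2 \<le> 1 \<Longrightarrow> 0 < k \<Longrightarrow> k \<le> CARD('n) \<Longrightarrow>
      ln (esym k (B + Y)) - ln (esym k (A + X))
        \<le> desym k (A + X) ((B + Y) - (A + X)) / esym k (A + X) + C * \<delta>\<^sup>2"
proof -
  obtain C0 :: real where C0: "0 \<le> C0" and mixed: "\<And>(A :: real ^ 'n ^ 'n) X Y \<theta>.
      sym_pd A \<Longrightarrow> rel_skew \<theta> A X \<Longrightarrow> rel_skew \<theta> A Y \<Longrightarrow> \<theta>\<^sup>2 \<le> 1 \<Longrightarrow> k \<le> CARD('n) \<Longrightarrow>
      \<bar>desym k (A + X) Y\<bar> \<le> C0 * \<theta>\<^sup>2 * esym k A"
    using desym_skew_skew_bound[of k] by blast
  have "ln (esym k (B + Y)) - ln (esym k (A + X))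
      \<le> desym k (A + X) ((B + Y) - (A + X)) / esym k (A + X) + (C0 + real k + (real k)\<^sup>2) * \<delta>\<^sup>2"
    if A: "sym_pd A" and B: "sym_pd B" and X: "rel_skew \<delta> A X" and Y: "rel_skew \<delta> A Y" "rel_skew \<delta> B Y"
      and \<delta>: "\<delta>\<^sup>2 \<le> 1" and k: "0 < k" "k \<le> CARD('n)"
    for A X B Y :: "real ^ 'n ^ 'n" and \<delta>
  proof -
    define S0 S1 P0 P1 where "S0 = esym k A" and "S1 = esym k B" and "P0 = esym k (A + X)" and "P1 = esym k (B + Y)"
    note defs = S0_def S1_def P0_def P1_def
    have pos: "0 < S0" "0 < S1" "0 < P0" "0 < P1"
      unfolding defs using esym_pd_pos A B esym_pd_skew_pos X Y(2) k(2) by blast+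
    define q where "q = (1 + \<delta>\<^sup>2) ^ k"
    have q: "0 < q" by (simp add: q_def add_pos_nonneg)
    have "ln (1 + \<delta>\<^sup>2) \<le> \<delta>\<^sup>2" by (rule ln_add_one_self_le_self) simp
    then have lnq: "ln q \<le> k * \<delta>\<^sup>2"
      by (simp add: q_def ln_realpow add_pos_nonneg mult_left_mono)
    have "P1 \<le> S1 * q" unfolding defs q_def using B Y(2) k(2) by (rule esym_skew_perturbed_le)
    then have "ln P1 \<le> ln (S1 * q)" using pos q by simp
    then have up: "ln P1 \<le> ln S1 + k * \<delta>\<^sup>2" using pos q lnq by (simp add: ln_mult_pos)
    have S0P0: "S0 \<le> P0" unfolding defs using A X k(2) by (rule esym_le_skew_perturbed)
    then have low: "ln S0 \<le> ln P0" using pos by simp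
    have "ln S1 - ln S0 \<le> (1 / q) * (desym k A B / S0) - k - k * ln (1 / q)"
      unfolding defs using A B k(2) q by (intro ln_esym_le_tangent) auto
    moreover have "- (k * ln (1 / q)) \<le> (real k)\<^sup>2 * \<delta>\<^sup>2"
      using mult_left_mono[OF lnq, of "real k"] q by (simp add: ln_div power2_eq_square mult.assoc)
    ultimately have tangent: "ln S1 - ln S0 \<le> (1 / q) * (desym k A B / S0) - k + (real k)\<^sup>2 * \<delta>\<^sup>2" by linarith
    have d0: "0 < desym k A B" using desym_pd_skew_pos[OF A rel_skew_zero B k] by simp
    have "P0 \<le> S0 * q" unfolding defs q_def using A X k(2) by (rule esym_skew_perturbed_le)
    then have "desym k A B / (S0 * q) \<le> desym k A B / P0"
      using pos q d0 by (intro divide_left_mono) auto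
    also have "\<dots> \<le> desym k (A + X) B / P0"
      using desym_le_skew_perturbed[OF A X B k] pos by (intro divide_right_mono) auto
    finally have main: "(1 / q) * (desym k A B / S0) \<le> desym k (A + X) B / P0" by (simp add: mult.commute)
    have "\<bar>desym k (A + X) Y\<bar> \<le> C0 * \<delta>\<^sup>2 * S0" unfolding defs using A X Y(1) \<delta> k(2) by (rule mixed)
    also have "\<dots> \<le> C0 * \<delta>\<^sup>2 * P0" using S0P0 C0 by (intro mult_left_mono) auto
    finally have "- (C0 * \<delta>\<^sup>2) \<le> desym k (A + X) Y / P0" using pos by (simp add: le_divide_eq)
    moreover have "desym k (A + X) ((B + Y) - (A + X)) / P0 = desym k (A + X) B / P0 + desym k (A + X) Y / P0 - k"
      unfolding desym_diff_right[of k "A + X" "B + Y" "A + X"] desym_add_right[of k "A + X" B Y] desym_self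
      using pos by (simp add: P0_def[symmetric] diff_divide_distrib add_divide_distrib)
    ultimately have "ln P1 - ln P0 \<le> desym k (A + X) ((B + Y) - (A + X)) / P0 + (C0 * \<delta>\<^sup>2 + k * \<delta>\<^sup>2 + (real k)\<^sup>2 * \<delta>\<^sup>2)"
      using up low tangent main by linarith
    then show ?thesis unfolding P0_def P1_def by (simp add: distrib_right)
  qed
  moreover have "0 \<le> C0 + real k + (real k)\<^sup>2" using C0 by simp
  ultimately show thesis using that by blast
qed

lemma D_gamma_decomposition:
  assumes "R \<in> D_gamma \<delta> \<mu> \<gamma>"
  obtains A X where "R = A + X" and "sym_pd A" and "transpose X = - X"
    and "\<And>x. norm (X *v x) \<le> \<mu> * norm x" and "\<mu> \<le> \<delta> * lambda_min A"
proof -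
  from assms have "R \<in> D_dom \<delta> \<mu>" by (auto simp: D_gamma_def)
  then obtain A X where R: "R = A + X" "sym_pd A" "transpose X = - X"
    and X: "onorm ((*v) X) \<le> \<mu>" and \<mu>: "\<mu> \<le> \<delta> * lambda_min A"
    by (auto simp: D_dom_def)
  have "norm (X *v x) \<le> \<mu> * norm x" for x
    using onorm[OF matrix_vector_mul_bounded_linear, of X x] mult_right_mono[OF X norm_ge_zero[of x]] by linarith
  then show thesis using that R \<mu> by blast
qed

theorem theorem5p5:
  fixes k :: nat and \<gamma> :: real
  assumes "2 \<le> k" and "k \<le> CARD('n::finite) - 1"
    and "admissible_gamma CARD('n) k \<gamma>"
  shows "\<exists>\<delta>1 C12. 0 < \<delta>1 \<and> \<delta>1 < 1 \<and> 0 < C12 \<and>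
    (\<forall>\<mu>>0. \<forall>\<delta>. 0 < \<delta> \<and> \<delta> \<le> \<delta>1 \<longrightarrow>
      (\<forall>R0 \<in> D_gamma \<delta> \<mu> \<gamma>. \<forall>R1 \<in> D_gamma \<delta> \<mu> \<gamma>.
         F_k k R1 - F_k k (R0 :: real ^ 'n ^ 'n) \<le>
           (\<Sum>i\<in>UNIV. \<Sum>j\<in>UNIV. entry_deriv (F_k k) i j R0 * (R1 $ i $ j - R0 $ i $ j))
           + 4 * real CARD('n) * C12 * \<delta>\<^sup>2))"
proof -
  \<comment> \<open>every \<open>\<delta>1 < 1\<close> would do; \<open>C + 1\<close> instead of \<open>C\<close> makes the constant positive\<close>
  have k: "0 < k" "k \<le> CARD('n)" using assms(1,2) by auto
  obtain C :: real where C: "0 \<le> C" and est: "\<And>(A :: real ^ 'n ^ 'n) X B Y \<delta>.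
      sym_pd A \<Longrightarrow> sym_pd B \<Longrightarrow> rel_skew \<delta> A X \<Longrightarrow> rel_skew \<delta> A Y \<Longrightarrow> rel_skew \<delta> B Y \<Longrightarrow>
      \<delta>\<^sup>2 \<le> 1 \<Longrightarrow> 0 < k \<Longrightarrow> k \<le> CARD('n) \<Longrightarrow>
      ln (esym k (B + Y)) - ln (esym k (A + X))
        \<le> desym k (A + X) ((B + Y) - (A + X)) / esym k (A + X) + C * \<delta>\<^sup>2"
    using ln_esym_d_concave[of k] by blast
  have "F_k k R1 - F_k k R0 \<le>
      (\<Sum>i\<in>UNIV. \<Sum>j\<in>UNIV. entry_deriv (F_k k) i j R0 * (R1 $ i $ j - R0 $ i $ j))
        + 4 * real CARD('n) * (C + 1) * \<delta>\<^sup>2"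
    if \<mu>: "0 < \<mu>" and \<delta>: "0 < \<delta>" "\<delta> \<le> 1 / 2" and R0: "R0 \<in> D_gamma \<delta> \<mu> \<gamma>" and R1: "R1 \<in> D_gamma \<delta> \<mu> \<gamma>"
    for \<mu> \<delta> and R0 R1 :: "real ^ 'n ^ 'n"
  proof -
    obtain A X where A: "R0 = A + X" "sym_pd A" "transpose X = - X"
      "\<And>x. norm (X *v x) \<le> \<mu> * norm x" "\<mu> \<le> \<delta> * lambda_min A"
      using D_gamma_decomposition[OF R0] by metis
    obtain B Y where B: "R1 = B + Y" "sym_pd B" "transpose Y = - Y"
      "\<And>x. norm (Y *v x) \<le> \<mu> * norm x" "\<mu> \<le> \<delta> * lambda_min B"
      using D_gamma_decomposition[OF R1] by metis
    have rel: "rel_skew \<delta> M Z" if "sym_pd M" "transpose Z = - Z" "\<And>x. norm (Z *v x) \<le> \<mu> * norm x"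
      "\<mu> \<le> \<delta> * lambda_min M" for M Z :: "real ^ 'n ^ 'n"
      using that \<mu> \<delta> lambda_min_le_quadratic_form[of M]
      by (intro rel_skewI[where l = "lambda_min M" and m = \<mu>]) auto
    have X: "rel_skew \<delta> A X" using A(2-5) by (rule rel)
    have Y: "rel_skew \<delta> A Y" "rel_skew \<delta> B Y" using rel[OF A(2) B(3,4) A(5)] rel[OF B(2-5)] by auto
    have "\<delta>\<^sup>2 \<le> 1" using \<delta> by (simp add: power_le_one)
    then have "F_k k R1 - F_k k R0 \<le> desym k R0 (R1 - R0) / esym k R0 + C * \<delta>\<^sup>2"
      unfolding F_k_def S_k_eq_esym[OF k(2)] A(1) B(1) using A(2) B(2) X Y k by (intro est) auto
    also have "C * \<delta>\<^sup>2 \<le> 4 * real CARD('n) * (C + 1) * \<delta>\<^sup>2"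
    proof (rule mult_right_mono)
      have "C \<le> 1 * (C + 1)" by simp
      also have "\<dots> \<le> 4 * real CARD('n) * (C + 1)"
        using C k by (intro mult_right_mono) auto
      finally show "C \<le> 4 * real CARD('n) * (C + 1)" .
    qed simp
    also have "desym k R0 (R1 - R0) / esym k R0
        = (\<Sum>i\<in>UNIV. \<Sum>j\<in>UNIV. entry_deriv (F_k k) i j R0 * (R1 $ i $ j - R0 $ i $ j))"
      using sum_entry_deriv_F_k[OF k(2), of R0 "R1 - R0"] esym_pd_skew_pos[OF A(2) X k(2)] by (simp add: A(1))
    finally show ?thesis by simp
  qed
  then show ?thesis
    using C by (intro exI[of _ "1 / 2"] exI[of _ "C + 1"]) auto
qed

end
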